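(* Let $I$ be an independent set in a claw-free graph $G$. Let $C=c_0,c_1,\dots,c_{2n-1},c_{0}$ be an $I$-bad cycle ($c_0\in I$) with $I$-bipartition $[A,B]$, of length at least 8. Then $C$ is internally resolvable if and only if $D(G,C)$ or $D(G,C^{rev})$ contains a directed path from a vertex $b\in N_1(B)$ with $N(b)\cap I\subseteq A$ to a vertex in $A$.
   Context: A claw is the tree with four vertices and three leaves; a graph is claw-free if it has no induced claw. For $S\subseteq V(G)$ and integer $i$, $N_i(S)=\{v\in V(G)\setminus S : |N(v)\cap S|=i\}$. A walk $v_0,\dots,v_k$ is $I$-alternating if $|\{v_i,v_{i+1}\}\cap I|=1$ for all $i$. A cycle $v_0,\dots,v_k=v_0$ is chordless if $G[\{v_0,\dots,v_{k-1}\}]$ is a cycle. A cycle is $I$-bad if it is $I$-alternating and chordless. The $I$-bipartition of an $I$-bad cycle $C$ is the ordered pair $[V(C)\cap I, V(C)\setminus I]$. A move $u\to v$ (sliding a token from $u$ to $v$) transforms an independent set $I$ into $I-u+v$, where $uv\in E(G)$, $u\in I$, and the result is independent; a TS-sequence is a sequence of independent sets each obtained from the previous one by such a move. An $I$-bad cycle $C$ with $I$-bipartition $[A,B]$ is resolvable if there is a TS-sequence from $I$ to some independent set $I'$ such that $G[I'\cup B]$ has no cycles (a resolving sequence). A move $u\to v$ is internal if $\{u,v\}\subseteq N_2(B)$; a resolving sequence is internal if every move except the last is internal; $C$ is internally resolvable if an internal resolving sequence exists. Write $C=c_0,c_1,\ldots,c_{2n-1},c_0$ with $c_i\in I$ for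 even $i$. For $i\in\{0,\ldots,n-1\}$ the layer is $L_i=\{v\in V(G) : N(v)\cap B=N(c_{2i})\cap B\}$. For such a cycle of length at least 8, $D(G,C)$ is the digraph on vertex set $V(G)$ with arcs: for every $i\in\{0,\ldots,n-1\}$ and all $u\in L_i$, $v\in L_{(i+1)\bmod n}$ with $uv\notin E(G)$, an arc $(u,v)$; and for every $i\in\{0,\ldots,n-1\}$, every $b\in N_1(B)$ with $N(b)\cap B=\{c_{(2i-1)\bmod 2n}\}$, and every $v\in L_i$ with $bv\notin E(G)$, an arc $(b,v)$. $C^{rev}=c_0,c_{2n-1},\ldots,c_1,c_0$ is the reversed cycle, and $D(G,C^{rev})$ is defined in the same way using this reversed labelling (so arcs between layers are reversed, and arcs from $N_1(B)$ go to different layers). *)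

theory Defs
  imports "Graph_Theory.Graph_Theory"
begin

text \<open>
  A finite simple graph is a \<open>pair_graph\<close>: each edge \<open>uv\<close> is represented by the two arcs
  \<open>(u, v)\<close> and \<open>(v, u)\<close>. The library's \<open>pre_digraph.cycle\<close> and \<open>forest\<close> are unsuitable here, as
  they count \<open>u, v, u\<close> as a cycle; undirected cycles are therefore defined below.
\<close>

definition nbhd :: "'a pair_pre_digraph \<Rightarrow> 'a \<Rightarrow> 'a set" where
  "nbhd G v = {u. (v, u) \<in> parcs G}"

definition nbhd_count :: "'a pair_pre_digraph \<Rightarrow> nat \<Rightarrow> 'a set \<Rightarrow> 'a set" where
  "nbhd_count G i S = {v \<in> pverts G - S. card (nbhd G v \<inter> S) = i}"

definition independent_set :: "'a pair_pre_digraph \<Rightarrow> 'a set \<Rightarrow> bool" where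
  "independent_set G S \<longleftrightarrow> S \<subseteq> pverts G \<and> (\<forall>u\<in>S. \<forall>v\<in>S. (u, v) \<notin> parcs G)"

definition is_claw :: "('a, 'b) pre_digraph \<Rightarrow> bool" where
  "is_claw H \<longleftrightarrow> (\<exists>c x y z. distinct [c, x, y, z] \<and> verts H = {c, x, y, z} \<and>
     arcs_ends H = {(c, x), (c, y), (c, z), (x, c), (y, c), (z, c)})"

definition claw_free :: "'a pair_pre_digraph \<Rightarrow> bool" where
  "claw_free G \<longleftrightarrow> \<not> (\<exists>S \<subseteq> pverts G. is_claw (with_proj G \<restriction> S))"

text \<open>
  A cycle \<open>v\<^sub>0, \<dots>, v\<^sub>k = v\<^sub>0\<close> is represented by the list \<open>[v\<^sub>0, \<dots>, v\<^sub>k\<^sub>-\<^sub>1]\<close> of length \<open>k\<close>.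
\<close>

definition close_cycle :: "'a list \<Rightarrow> 'a list" where
  "close_cycle cs = cs @ [hd cs]"

definition ucycle :: "('a, 'b) pre_digraph \<Rightarrow> 'a list \<Rightarrow> bool" where
  "ucycle H cs \<longleftrightarrow> 3 \<le> length cs \<and> distinct cs \<and> vwalk (close_cycle cs) H"

definition cycle_graph :: "('a, 'b) pre_digraph \<Rightarrow> bool" where
  "cycle_graph H \<longleftrightarrow> (\<exists>ds. ucycle H ds \<and> verts H = set ds \<and>
     arcs_ends H = set (vwalk_arcs (close_cycle ds)) \<union> (set (vwalk_arcs (close_cycle ds)))\<inverse>)"

definition chordless :: "'a pair_pre_digraph \<Rightarrow> 'a list \<Rightarrow> bool" where
  "chordless G cs \<longleftrightarrow> cycle_graph (with_proj G \<restriction> set cs)"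

definition alternating :: "'a set \<Rightarrow> 'a list \<Rightarrow> bool" where
  "alternating I w \<longleftrightarrow> (\<forall>i. Suc i < length w \<longrightarrow> card ({w ! i, w ! Suc i} \<inter> I) = 1)"

definition bad_cycle :: "'a pair_pre_digraph \<Rightarrow> 'a set \<Rightarrow> 'a list \<Rightarrow> bool" where
  "bad_cycle G I cs \<longleftrightarrow>
     ucycle (with_proj G) cs \<and> alternating I (close_cycle cs) \<and> chordless G cs"

definition bipartition :: "'a set \<Rightarrow> 'a list \<Rightarrow> 'a set \<times> 'a set" where
  "bipartition I cs = (set cs \<inter> I, set cs - I)"

definition ts_move :: "'a pair_pre_digraph \<Rightarrow> 'a set \<Rightarrow> 'a \<Rightarrow> 'a \<Rightarrow> 'a set \<Rightarrow> bool" where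
  "ts_move G J u v J' \<longleftrightarrow> independent_set G J \<and> (u, v) \<in> parcs G \<and> u \<in> J \<and>
     J' = insert v (J - {u}) \<and> independent_set G J'"

definition ts_sequence :: "'a pair_pre_digraph \<Rightarrow> 'a set list \<Rightarrow> bool" where
  "ts_sequence G Js \<longleftrightarrow> Js \<noteq> [] \<and> (\<forall>J \<in> set Js. independent_set G J) \<and>
     (\<forall>i. Suc i < length Js \<longrightarrow> (\<exists>u v. ts_move G (Js ! i) u v (Js ! Suc i)))"

definition resolving_sequence ::
    "'a pair_pre_digraph \<Rightarrow> 'a set \<Rightarrow> 'a list \<Rightarrow> 'a set list \<Rightarrow> bool" where
  "resolving_sequence G I cs Js \<longleftrightarrow> ts_sequence G Js \<and> hd Js = I \<and>
     \<not> (\<exists>ds. ucycle (with_proj G \<restriction> (last Js \<union> snd (bipartition I cs))) ds)"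

text \<open>
  The \<open>i\<close>-th move of \<open>Js\<close> leads from \<open>Js ! i\<close> to \<open>Js ! Suc i\<close>, so the moves other than the last
  are those with \<open>Suc (Suc i) < length Js\<close>. The vertices \<open>u\<close> and \<open>v\<close> of a move are determined by
  the two sets.
\<close>

definition internal_resolving_sequence ::
    "'a pair_pre_digraph \<Rightarrow> 'a set \<Rightarrow> 'a list \<Rightarrow> 'a set list \<Rightarrow> bool" where
  "internal_resolving_sequence G I cs Js \<longleftrightarrow> resolving_sequence G I cs Js \<and>
     (\<forall>i u v. Suc (Suc i) < length Js \<and> ts_move G (Js ! i) u v (Js ! Suc i) \<longrightarrow>
        {u, v} \<subseteq> nbhd_count G 2 (snd (bipartition I cs)))"

definition internally_resolvable :: "'a pair_pre_digraph \<Rightarrow> 'a set \<Rightarrow> 'a list \<Rightarrow> bool" where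
  "internally_resolvable G I cs \<longleftrightarrow> (\<exists>Js. internal_resolving_sequence G I cs Js)"

definition layer :: "'a pair_pre_digraph \<Rightarrow> 'a set \<Rightarrow> 'a list \<Rightarrow> nat \<Rightarrow> 'a set" where
  "layer G I cs i =
     (let B = snd (bipartition I cs)
      in {v \<in> pverts G. nbhd G v \<inter> B = nbhd G (cs ! (2 * i)) \<inter> B})"

text \<open>
  The index \<open>(2 * i + 2 * n - 1) mod (2 * n)\<close> is \<open>2i - 1\<close> modulo \<open>2n\<close>, written so as to avoid
  truncated subtraction at \<open>i = 0\<close>.
\<close>

definition layer_digraph ::
    "'a pair_pre_digraph \<Rightarrow> 'a set \<Rightarrow> 'a list \<Rightarrow> 'a pair_pre_digraph" where
  "layer_digraph G I cs =
     (let n = length cs div 2; B = snd (bipartition I cs)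
      in \<lparr> pverts = pverts G,
           parcs =
             {(u, v) | u v i. i < n \<and> u \<in> layer G I cs i \<and> v \<in> layer G I cs ((i + 1) mod n) \<and>
                (u, v) \<notin> parcs G} \<union>
             {(b, v) | b v i. i < n \<and> b \<in> nbhd_count G 1 B \<and>
                nbhd G b \<inter> B = {cs ! ((2 * i + 2 * n - 1) mod (2 * n))} \<and>
                v \<in> layer G I cs i \<and> (b, v) \<notin> parcs G} \<rparr>)"

definition rev_cycle :: "'a list \<Rightarrow> 'a list" where
  "rev_cycle cs = hd cs # rev (tl cs)"

end

theory Submission
  imports Defs
begin

text \<open>
  As long as no token leaves a layer, the tokens that started on the cycle form a configuration
  \<open>x\<close>: one token \<open>x i\<close> in every layer \<open>L\<^sub>i\<close>, pairwise non-adjacent. By claw-freeness every internal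
  move keeps its token within its layer, and the last move leads from some \<open>x i\<close> to a vertex \<open>b\<close> with a single
  neighbour in \<open>B\<close>.

  If the cycle is internally resolvable, then by induction over the moves every token reaches \<open>A\<close>
  in the digraph and in its reversed version: a token that moved to \<open>v\<close> has the arcs from \<open>v\<close> to both neighbouring
  tokens. The vertex \<open>b\<close> of the last move has an arc to one neighbouring token of \<open>x i\<close>.

  Conversely, take a path \<open>b = p\<^sub>0, \<dots>, p\<^sub>k = x m\<close> that cannot be shortened, and the token \<open>x (m - 1)\<close>
  preceding its end. Either this token can move to \<open>p\<^sub>k\<^sub>-\<^sub>1\<close>, which shortens the path, or \<open>p\<^sub>k\<^sub>-\<^sub>1\<close> is
  adjacent to \<open>x (m - 2)\<close>. In the second case claw-freeness propagates this adjacency along the path down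
  to \<open>p\<^sub>1\<close>, which forces \<open>b\<close> to be adjacent to exactly one token, so that \<open>b\<close> is reached at once.
\<close>

section \<open>Configurations in a claw-free graph\<close>

text \<open>
  The vertices \<open>\<beta> i\<close> are the set \<open>B\<close> in cyclic order, \<open>\<beta> i\<close> being the cycle vertex
  \<open>c\<^sub>2\<^sub>i\<^sub>+\<^sub>1\<close>, and \<open>R\<close> is the set of tokens off the cycle. Indices are integers and \<open>\<beta>\<close> has period
  \<open>n\<close>; equality of indices modulo \<open>n\<close> is expressed as equality of the values of \<open>\<beta>\<close>.
\<close>

locale claw_free_ring =
  fixes adj :: "'a \<Rightarrow> 'a \<Rightarrow> bool" and \<beta> :: "int \<Rightarrow> 'a" and n :: int and R :: "'a set"
  assumes adj_sym: "adj u v \<Longrightarrow> adj v u"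
    and adj_irrefl: "\<not> adj u u"
    and no_claw: "\<lbrakk>adj c x; adj c y; adj c z; x \<noteq> y; x \<noteq> z; y \<noteq> z\<rbrakk>
      \<Longrightarrow> adj x y \<or> adj x z \<or> adj y z"
    and n_ge: "4 \<le> n"
    and \<beta>_eq_iff: "\<beta> i = \<beta> j \<longleftrightarrow> n dvd (i - j)"
    and \<beta>_indep: "\<not> adj (\<beta> i) (\<beta> j)"
    and R_\<beta>: "r \<in> R \<Longrightarrow> \<not> adj r (\<beta> i)"
    and R_not_\<beta>: "r \<in> R \<Longrightarrow> r \<noteq> \<beta> i"
    and R_indep: "\<lbrakk>r \<in> R; s \<in> R\<rbrakk> \<Longrightarrow> \<not> adj r s"
begin

section \<open>Layers and the adjacencies forced by claw-freeness\<close>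

lemma adj_commute: "adj u v \<longleftrightarrow> adj v u"
  using adj_sym by blast

lemma \<beta>_neq: "0 < \<bar>i - j\<bar> \<Longrightarrow> \<bar>i - j\<bar> < 4 \<Longrightarrow> \<beta> i \<noteq> \<beta> j"
  using \<beta>_eq_iff[of i j] n_ge zdvd_imp_le[of n "\<bar>i - j\<bar>"] by auto

lemma \<beta>_shift: "\<beta> (i + k) = \<beta> (j + k) \<longleftrightarrow> \<beta> i = \<beta> j"
  by (simp add: \<beta>_eq_iff)

lemma \<beta>_shift_neg: "\<beta> (i - k) = \<beta> (j - k) \<longleftrightarrow> \<beta> i = \<beta> j"
  by (simp add: \<beta>_eq_iff)

text \<open>The layer of the cycle vertex between \<open>\<beta> (j - 1)\<close> and
  \<open>\<beta> j\<close>.\<close>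

definition L :: "int \<Rightarrow> 'a set" where
  "L j = {v. \<forall>i. adj v (\<beta> i) \<longleftrightarrow> \<beta> i = \<beta> j \<or> \<beta> i = \<beta> (j - 1)}"

definition N1 :: "int \<Rightarrow> 'a set" where
  "N1 j = {v. \<forall>i. adj v (\<beta> i) \<longleftrightarrow> \<beta> i = \<beta> j}"

lemma L_adj: "v \<in> L j \<Longrightarrow> adj v (\<beta> i) \<longleftrightarrow> \<beta> i = \<beta> j \<or> \<beta> i = \<beta> (j - 1)"
  by (simp add: L_def)

lemma N1_adj: "v \<in> N1 j \<Longrightarrow> adj v (\<beta> i) \<longleftrightarrow> \<beta> i = \<beta> j"
  by (simp add: N1_def)

lemma L_cong: "\<beta> i = \<beta> j \<Longrightarrow> L i = L j"
  unfolding L_def using \<beta>_shift_neg[of i 1 j] by simp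

text \<open>Distinct indices would describe the same pair crosswise, giving
  \<open>\<beta> (j - 2) = \<beta> j\<close>, which \<open>n_ge\<close> excludes.\<close>

lemma L_unique:
  assumes "v \<in> L i" "v \<in> L j"
  shows "\<beta> i = \<beta> j"
proof (rule ccontr)
  assume ne: "\<beta> i \<noteq> \<beta> j"
  have "\<beta> i = \<beta> (j - 1)" "\<beta> j = \<beta> (i - 1)"
    using L_adj[OF assms(1), of i] L_adj[OF assms(2), of i]
      L_adj[OF assms(1), of j] L_adj[OF assms(2), of j] ne by auto
  then have "\<beta> (j - 1 - 1) = \<beta> j"
    using \<beta>_shift_neg[of i 1 "j - 1"] by simp
  then show False using \<beta>_neq[of "j - 1 - 1" j] by simp
qed

lemma L_N1_disjoint: "v \<in> L i \<Longrightarrow> v \<notin> N1 j"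
  using L_adj[of v i i] L_adj[of v i "i - 1"] N1_adj[of v j i] N1_adj[of v j "i - 1"] \<beta>_neq[of i "i - 1"]
  by auto

lemma N1_unique: "v \<in> N1 i \<Longrightarrow> v \<in> N1 j \<Longrightarrow> \<beta> i = \<beta> j"
  using N1_adj by blast

lemma L_not_\<beta>: "v \<in> L j \<Longrightarrow> v \<noteq> \<beta> i"
  using L_adj \<beta>_indep by blast

lemma N1_not_\<beta>: "v \<in> N1 j \<Longrightarrow> v \<noteq> \<beta> i"
  using N1_adj \<beta>_indep by blast

lemma L_not_R: "v \<in> L j \<Longrightarrow> v \<notin> R"
  using L_adj R_\<beta> by blast

text \<open>Otherwise \<open>v\<close> is the centre of a claw with leaves \<open>\<beta> j\<close>,
  \<open>\<beta> (j - 1)\<close>, \<open>w\<close>.\<close>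

lemma adj_L_cases:
  assumes "v \<in> L j" "adj v w" "\<And>i. w \<noteq> \<beta> i"
  shows "adj w (\<beta> j) \<or> adj w (\<beta> (j - 1))"
  using no_claw[of v "\<beta> j" "\<beta> (j - 1)" w] L_adj[OF assms(1)] assms(2,3) \<beta>_indep
    \<beta>_neq[of j "j - 1"] adj_commute by auto

lemma L_R_nonadj: "v \<in> L j \<Longrightarrow> r \<in> R \<Longrightarrow> \<not> adj v r"
  using adj_L_cases[of v j r] R_\<beta> R_not_\<beta> by blast

text \<open>Otherwise \<open>\<beta> j\<close> is the centre of a claw with leaves \<open>u\<close>,
  \<open>w\<close>, \<open>v\<close>. Mostly used with \<open>u\<close>, \<open>w\<close> the two
  tokens around \<open>\<beta> j\<close>.\<close>

lemma adj_between:
  assumes "u \<in> L j" "w \<in> L (j + 1)" "\<not> adj u w" "adj v (\<beta> j)" "v \<noteq> u" "v \<noteq> w"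
  shows "adj v u \<or> adj v w"
proof -
  have "u \<noteq> w" using assms(1,2) L_unique[of u j "j+1"] \<beta>_neq[of j "j + 1"] by auto
  moreover have "adj (\<beta> j) u" "adj (\<beta> j) w" "adj (\<beta> j) v"
    using L_adj[OF assms(1), of j] L_adj[OF assms(2), of j] assms(4) adj_commute by auto
  ultimately show ?thesis
    using no_claw[of "\<beta> j" u w v] assms adj_commute by auto
qed

section \<open>Configurations and the effect of one move\<close>

definition config :: "(int \<Rightarrow> 'a) \<Rightarrow> bool" where
  "config x \<longleftrightarrow> (\<forall>i. x i \<in> L i) \<and> (\<forall>i j. \<beta> i = \<beta> j \<longrightarrow> x i = x j) \<and>
     (\<forall>i j. \<not> adj (x i) (x j)) \<and> (\<forall>i. \<forall>r\<in>R. \<not> adj (x i) r)"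

definition place :: "(int \<Rightarrow> 'a) \<Rightarrow> int \<Rightarrow> 'a \<Rightarrow> int \<Rightarrow> 'a" where
  "place x i v = (\<lambda>m. if \<beta> m = \<beta> i then v else x m)"

lemma config_L: "config x \<Longrightarrow> x i \<in> L i"
  and config_cong: "config x \<Longrightarrow> \<beta> i = \<beta> j \<Longrightarrow> x i = x j"
  and config_indep: "config x \<Longrightarrow> \<not> adj (x i) (x j)"
  and config_R: "config x \<Longrightarrow> r \<in> R \<Longrightarrow> \<not> adj (x i) r"
  unfolding config_def by blast+

lemma config_eq_iff: "config x \<Longrightarrow> x i = x j \<longleftrightarrow> \<beta> i = \<beta> j"
  using L_unique config_L config_cong by metis

text \<open>Only the two neighbouring tokens can block a move inside a layer: by
  \<open>adj_L_cases\<close> a token adjacent to \<open>v\<close> shares a neighbour in B with it,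
  so its index differs from \<open>i\<close> by at most one modulo \<open>n\<close>.\<close>

lemma config_place:
  assumes x: "config x" and v: "v \<in> L i"
    and nxt: "\<not> adj v (x (i + 1))" and prev: "\<not> adj v (x (i - 1))"
  shows "config (place x i v)"
proof -
  have *: "\<not> adj v (x m)" if "\<beta> m \<noteq> \<beta> i" for m
  proof
    assume "adj v (x m)"
    then have "adj (x m) (\<beta> i) \<or> adj (x m) (\<beta> (i - 1))"
      using adj_L_cases[OF v] L_not_\<beta>[OF config_L[OF x]] by blast
    then have "\<beta> i = \<beta> (m - 1) \<or> \<beta> (i - 1) = \<beta> m"
      using L_adj[OF config_L[OF x]] that \<beta>_shift_neg[of i 1 m] by metis
    then have "\<beta> m = \<beta> (i + 1) \<or> \<beta> m = \<beta> (i - 1)"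
      using \<beta>_shift[of i 1 "m - 1"] by auto
    then show False using \<open>adj v (x m)\<close> nxt prev config_cong[OF x] by metis
  qed
  show ?thesis
    unfolding config_def
  proof (intro conjI allI impI ballI)
    show "place x i v m \<in> L m" for m
      using config_L[OF x, of m] v L_cong[of m i] by (simp add: place_def)
    show "place x i v l = place x i v m" if "\<beta> l = \<beta> m" for l m
      using config_cong[OF x that] that by (simp add: place_def)
    show "\<not> adj (place x i v l) (place x i v m)" for l m
      using config_indep[OF x, of l m] *[of l] *[of m] adj_irrefl[of v] adj_commute[of "x l" v]
      by (simp add: place_def)
    show "\<not> adj (place x i v m) r" if "r \<in> R" for m r
      using config_R[OF x that] L_R_nonadj[OF v that] by (simp add: place_def)
  qed
qed

text \<open>For any other \<open>m\<close> both tokens around \<open>\<beta> m\<close> stay in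
  place, and \<open>adj_between\<close> makes \<open>v\<close> adjacent to or equal to one of
  them.\<close>

lemma moved_adj_\<beta>:
  assumes x: "config x" and others: "\<And>m. \<beta> m \<noteq> \<beta> i \<Longrightarrow> v \<noteq> x m \<and> \<not> adj v (x m)" and v: "adj v (\<beta> m)"
  shows "\<beta> m = \<beta> i \<or> \<beta> m = \<beta> (i - 1)"
proof (rule ccontr)
  assume "\<not> ?thesis"
  then have "\<beta> m \<noteq> \<beta> i" "\<beta> (m + 1) \<noteq> \<beta> i"
    using \<beta>_shift[of m 1 "i - 1"] by auto
  then show False
    using others adj_between[OF config_L[OF x, of m] config_L[OF x, of "m + 1"] config_indep[OF x] v] by blast
qed

text \<open>By \<open>adj_L_cases\<close>, \<open>v\<close> keeps one of the two neighbours of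
  \<open>x i\<close> in B, and by \<open>moved_adj_\<beta>\<close> it gains no other; keeping both
  would put it into \<open>L i\<close>.\<close>

lemma moved_N1:
  assumes x: "config x" and others: "\<And>m. \<beta> m \<noteq> \<beta> i \<Longrightarrow> v \<noteq> x m \<and> \<not> adj v (x m)"
    and v: "adj (x i) v" "v \<notin> range \<beta>" "v \<notin> L i"
  shows "v \<in> N1 i \<or> v \<in> N1 (i - 1)"
proof -
  have only: "adj v (\<beta> m) \<Longrightarrow> \<beta> m = \<beta> i \<or> \<beta> m = \<beta> (i - 1)" for m
    using moved_adj_\<beta>[OF x others] .
  have some: "adj v (\<beta> i) \<or> adj v (\<beta> (i - 1))"
    using adj_L_cases[OF config_L[OF x] v(1)] v(2) by blast
  have "\<not> (adj v (\<beta> i) \<and> adj v (\<beta> (i - 1)))"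
  proof
    assume "adj v (\<beta> i) \<and> adj v (\<beta> (i - 1))"
    then have "v \<in> L i" unfolding L_def mem_Collect_eq using only by metis
    with v(3) show False ..
  qed
  with only some show ?thesis unfolding N1_def mem_Collect_eq by metis
qed

text \<open>The ring part of an internal resolving sequence: \<open>step\<close> is an internal
  move, \<open>final\<close> the last move, to a vertex \<open>b\<close> whose only neighbour among
  the ring tokens is the moved one.\<close>

inductive solvable :: "'a \<Rightarrow> (int \<Rightarrow> 'a) \<Rightarrow> bool" for b where
  final: "\<lbrakk>config x; adj (x i) b; \<And>m. \<beta> m \<noteq> \<beta> i \<Longrightarrow> \<not> adj b (x m)\<rbrakk> \<Longrightarrow> solvable b x"
| step: "\<lbrakk>config x; v \<in> L i; adj (x i) v; config (place x i v); solvable b (place x i v)\<rbrakk>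
    \<Longrightarrow> solvable b x"

text \<open>\<open>adj_L_cases\<close> confines the tokens adjacent to \<open>b\<close> to the two
  around \<open>\<beta> j\<close>, and \<open>adj_between\<close> provides at least one of them. By
  \<open>free\<close> it is exactly one, and it can move to \<open>b\<close>.\<close>

lemma solvable_final:
  assumes x: "config x" and b: "b \<in> N1 j" and free: "\<not> adj b (x j) \<or> \<not> adj b (x (j + 1))"
  shows "solvable b x"
proof -
  have j: "adj b (\<beta> j)" using N1_adj[OF b] by simp
  have "b \<noteq> x j" "b \<noteq> x (j + 1)"
    using L_N1_disjoint[OF config_L[OF x]] b by metis+
  then have one: "adj b (x j) \<or> adj b (x (j + 1))"
    using adj_between[OF config_L[OF x] config_L[OF x] config_indep[OF x] j] by simp
  have far: "\<beta> m = \<beta> j \<or> \<beta> m = \<beta> (j + 1)" if "adj b (x m)" for m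
  proof -
    have "adj b (\<beta> m) \<or> adj b (\<beta> (m - 1))"
      using adj_L_cases[OF config_L[OF x]] that adj_commute N1_not_\<beta>[OF b] by metis
    then show ?thesis using N1_adj[OF b] \<beta>_shift[of "m - 1" 1 j] by auto
  qed
  show ?thesis
  proof (cases "adj b (x j)")
    case True
    then have "\<not> adj b (x m)" if "\<beta> m \<noteq> \<beta> j" for m
      using free far[of m] that config_cong[OF x, of m "j + 1"] by auto
    then show ?thesis using True adj_sym final[OF x, of j] by blast
  next
    case False
    then have "\<not> adj b (x m)" if "\<beta> m \<noteq> \<beta> (j + 1)" for m
      using far[of m] that config_cong[OF x, of m j] by auto
    then show ?thesis using False one adj_sym final[OF x, of "j + 1"] by blast
  qed
qed

text \<open>The induction on \<open>k\<close> keeps \<open>x\<close> and \<open>p\<close> arbitrary: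
  it is applied both to a diverted path for the same configuration and to a truncated path for a
  changed one.\<close>

lemma solvable_if_path:
  assumes b: "b \<in> N1 j" "p 0 = b" and x: "config x" and "1 \<le> k"
    and "\<And>s. 1 \<le> s \<Longrightarrow> s \<le> k \<Longrightarrow> p s \<in> L (j + int s)"
    and "\<And>s. s < k \<Longrightarrow> \<not> adj (p s) (p (Suc s))"
    and "p k = x (j + int k)"
  shows "solvable b x"
  using b(2) x assms(4-)
proof (induction k arbitrary: x p rule: less_induct)
  case (less k)
  note pL = less.prems(4) and p_nonadj = less.prems(5)
  note xL = config_L[OF less.prems(2)] and x_indep = config_indep[OF less.prems(2)]
  show ?case
  proof (rule ccontr)
    assume unsolvable: "\<not> solvable b x"
    \<comment> \<open>A path that meets a token early can be cut off there.\<close>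
    have neq: "p s \<noteq> x (j + int s)" if "1 \<le> s" "s < k" for s
      using less.IH[of s p x, OF that(2) less.prems(1,2) that(1)] pL p_nonadj that unsolvable by auto
    \<comment> \<open>Otherwise the path can be diverted to the token of the next layer, where it
      ends after \<open>Suc s\<close> steps.\<close>
    have adj_next: "adj (p s) (x (j + int (Suc s)))" if "Suc s < k" for s
    proof (rule ccontr)
      assume non: "\<not> adj (p s) (x (j + int (Suc s)))"
      define q where "q = p(Suc s := x (j + int (Suc s)))"
      have "solvable b x"
      proof (rule less.IH[of "Suc s" q x, OF that _ less.prems(2)])
        show "q 0 = b" using less.prems(1) by (simp add: q_def)
        show "q t \<in> L (j + int t)" if "1 \<le> t" "t \<le> Suc s" for t
          using that \<open>Suc s < k\<close> pL[of t] xL by (auto simp: q_def)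
        show "\<not> adj (q t) (q (Suc t))" if "t < Suc s" for t
          using that \<open>Suc s < k\<close> p_nonadj[of t] non by (auto simp: q_def)
      qed (simp_all add: q_def)
      with unsolvable show False ..
    qed
    \<comment> \<open>For \<open>k = 1\<close> the only arc says that \<open>b\<close> misses
      \<open>x (j + 1)\<close>, so \<open>solvable_final\<close> applies.\<close>
    have k: "2 \<le> k"
    proof (rule ccontr)
      assume "\<not> 2 \<le> k"
      then have "k = 1" using less.prems(3) by simp
      then have "\<not> adj b (x (j + 1))"
        using p_nonadj[of 0] less.prems(1,6) by simp
      then show False using solvable_final[OF less.prems(2) b(1)] unsolvable by simp
    qed
    \<comment> \<open>The last vertex before the end of the path; \<open>x i\<close> will be the
      token of its layer, which is to move to \<open>v\<close>.\<close>
    define v where "v = p (k - 1)"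
    have kk: "Suc (k - 1) = k" using k by simp
    define i where "i = j + int (k - 1)"
    have ik: "j + int k = i + 1" using k by (simp add: i_def)
    have vL: "v \<in> L i" using pL[of "k - 1"] k by (simp add: v_def i_def)
    have v_next: "\<not> adj v (x (i + 1))"
      using p_nonadj[of "k - 1"] kk less.prems(6) ik k by (simp add: v_def)
    have v_neq: "v \<noteq> x i" using neq[of "k - 1"] k by (simp add: v_def i_def)
    have "v \<noteq> x (i + 1)"
      using L_unique[of v i "i + 1"] vL xL[of "i + 1"] \<beta>_neq[of i "i + 1"] by auto
    then have v_adj: "adj v (x i)"
      using adj_between[OF xL[of i] xL[of "i + 1"] x_indep, of v] v_neq v_next L_adj[OF vL, of i] by auto
    \<comment> \<open>Otherwise \<open>x i\<close> can move to \<open>v\<close>, and for the new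
      configuration the path already ends at \<open>p (k - 1)\<close>.\<close>
    have v_prev: "adj v (x (i - 1))"
    proof (rule ccontr)
      assume "\<not> adj v (x (i - 1))"
      then have c: "config (place x i v)"
        using config_place[OF less.prems(2) vL v_next] by blast
      have "solvable b (place x i v)"
        by (rule less.IH[of "k - 1" p "place x i v"])
          (use k c less.prems(1) pL p_nonadj in \<open>auto simp: place_def v_def i_def\<close>)
      then show False
        using step[OF less.prems(2) vL _ c] v_adj adj_commute unsolvable by blast
    qed
    \<comment> \<open>Downward induction from \<open>s = k - 2\<close>, where the claim is
      \<open>v_prev\<close>, to \<open>s = 0\<close>, where \<open>p 1\<close> is adjacent to
      \<open>x j\<close>.\<close>
    have backward: "adj (p (Suc s)) (x (j + int s))" if "s \<le> k - 2" for s
      using that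
    proof (induction s rule: inc_induct)
      case base
      have "Suc (k - 2) = k - 1" "j + int (k - 2) = i - 1" using k by (auto simp: i_def)
      then show ?case using v_prev by (simp only: v_def)
    next
      case (step s)
      define l where "l = j + int (Suc s)"
      have ls: "j + int s = l - 1" "j + int (Suc (Suc s)) = l + 1" by (auto simp: l_def)
      have lt: "Suc (Suc s) < k" using step.hyps by simp
      let ?u = "p s" and ?w = "p (Suc s)" and ?z = "p (Suc (Suc s))"
      have w: "?w \<in> L l" and z: "?z \<in> L (l + 1)" using pL[of "Suc s"] pL[of "Suc (Suc s)"] lt
        by (auto simp: l_def algebra_simps)
      have u: "?u \<in> L (l - 1) \<or> ?u \<in> N1 (l - 1)"
        using pL[of s] b lt ls less.prems(1) by (cases "s = 0") auto
      have u_\<beta>: "?u \<noteq> \<beta> m" for m using u L_not_\<beta> N1_not_\<beta> by blast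
      have u_only: "\<not> adj ?u (\<beta> (l + 1))" "\<not> adj ?u (\<beta> l)"
        using u L_adj[of ?u "l - 1"] N1_adj[of ?u "l - 1"] \<beta>_neq[of "l + 1" "l - 1"]
          \<beta>_neq[of "l + 1" "l - 1 - 1"] \<beta>_neq[of "l" "l - 1"] \<beta>_neq[of "l" "l - 1 - 1"] by auto
      \<comment> \<open>Only here \<open>n \<noteq> 3\<close> matters: otherwise \<open>\<beta> (l + 1) = \<beta> (l - 2)\<close> may be adjacent to \<open>p s\<close>.\<close>
      have u_z: "\<not> adj ?u ?z"
        using adj_L_cases[OF z _ u_\<beta>] u_only adj_commute by auto
      have dist: "?u \<noteq> ?w" "?u \<noteq> ?z" "?w \<noteq> ?z"
        using u_only L_adj[OF w, of l] L_adj[OF z, of "l + 1"] L_adj[OF w, of "l + 1"]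
          \<beta>_neq[of "l + 1" l] \<beta>_neq[of "l + 1" "l - 1"] by auto
      \<comment> \<open>Otherwise \<open>x l\<close> is the centre of a claw with leaves \<open>p s\<close>, \<open>p (s + 1)\<close>, \<open>p (s + 2)\<close>.\<close>
      have "\<not> adj ?w (x l)"
        using no_claw[of "x l" ?u ?w ?z] adj_next[of s] step.IH dist u_z
          p_nonadj[of s] p_nonadj[of "Suc s"] lt adj_commute by (auto simp: l_def)
      moreover have "?w \<noteq> x (l - 1)"
        using L_unique[OF w, of "l - 1"] xL[of "l - 1"] \<beta>_neq[of l "l - 1"] by auto
      moreover have "?w \<noteq> x l" using neq[of "Suc s"] lt by (simp add: l_def)
      \<comment> \<open>Of the two tokens around \<open>\<beta> (l - 1)\<close>, \<open>x l\<close>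
        has just been ruled out.\<close>
      ultimately have "adj ?w (x (l - 1))"
        using adj_between[OF xL[of "l - 1"] _ x_indep, of l ?w] xL[of l] L_adj[OF w, of "l - 1"] by auto
      then show ?case by (simp add: ls)
    qed
    have w: "p 1 \<in> L (j + 1)" using pL[of 1] k by simp
    \<comment> \<open>Otherwise \<open>x j\<close> is the centre of a claw with leaves
      \<open>b\<close>, \<open>p 1\<close>, \<open>\<beta> (j - 1)\<close>.\<close>
    have "\<not> adj b (x j)"
    proof
      assume "adj b (x j)"
      moreover have "adj (p 1) (x j)" using backward[of 0] by simp
      moreover have "adj (x j) (\<beta> (j - 1))" using L_adj[OF xL] by simp
      moreover have "\<not> adj b (p 1)" using p_nonadj[of 0] k less.prems(1) by simp
      moreover have "\<not> adj b (\<beta> (j - 1))" using N1_adj[OF b(1)] \<beta>_neq[of j "j - 1"] by auto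
      moreover have "\<not> adj (p 1) (\<beta> (j - 1))"
        using L_adj[OF w, of "j - 1"] \<beta>_neq[of "j - 1" "j"] \<beta>_neq[of "j - 1" "j + 1"] by auto
      moreover have "b \<noteq> p 1" "b \<noteq> \<beta> (j - 1)" "p 1 \<noteq> \<beta> (j - 1)"
        using L_N1_disjoint[OF w] b N1_not_\<beta> L_not_\<beta>[OF w] by auto
      ultimately show False using no_claw[of "x j" b "p 1" "\<beta> (j - 1)"] adj_commute by auto
    qed
    then show False using solvable_final[OF less.prems(2) b(1)] unsolvable by simp
  qed
qed

end

section \<open>Cyclic lists\<close>

text \<open>Integer indices spare the case distinctions at the wrap-around and turn reversal into
  negation.\<close>

definition cyc :: "'a list \<Rightarrow> int \<Rightarrow> 'a" where
  "cyc cs i = cs ! nat (i mod int (length cs))"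

lemma cyc_nth: "k < length cs \<Longrightarrow> cyc cs (int k) = cs ! k"
  by (simp add: cyc_def)

lemma cyc_eq_iff:
  assumes "distinct cs" "cs \<noteq> []"
  shows "cyc cs i = cyc cs j \<longleftrightarrow> int (length cs) dvd (i - j)"
proof -
  have pos: "0 < int (length cs)" using assms(2) by simp
  have "cyc cs i = cyc cs j \<longleftrightarrow> nat (i mod int (length cs)) = nat (j mod int (length cs))"
    unfolding cyc_def using assms(1) pos by (intro nth_eq_iff_index_eq) (simp_all add: nat_less_iff)
  also have "\<dots> \<longleftrightarrow> i mod int (length cs) = j mod int (length cs)"
    using pos by (simp add: eq_nat_nat_iff)
  finally show ?thesis by (simp add: mod_eq_dvd_iff)
qed

lemma cyc_cong: "int (length cs) dvd (i - j) \<Longrightarrow> cyc cs i = cyc cs j"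
  unfolding cyc_def by (simp add: mod_eq_dvd_iff[symmetric])

lemma range_cyc: "cs \<noteq> [] \<Longrightarrow> range (cyc cs) = set cs"
proof (intro equalityI subsetI)
  fix v assume "cs \<noteq> []" "v \<in> range (cyc cs)"
  then show "v \<in> set cs" by (auto simp: cyc_def nat_less_iff)
next
  fix v assume "v \<in> set cs"
  then show "v \<in> range (cyc cs)" using cyc_nth by (metis in_set_conv_nth rangeI)
qed

lemma set_vwalk_arcs: "set (vwalk_arcs w) = {(w ! i, w ! Suc i) | i. Suc i < length w}"
proof (induction w rule: vwalk_arcs.induct)
  case (3 x y xs)
  show ?case unfolding vwalk_arcs.simps list.set 3
  proof (intro equalityI subsetI)
    fix e assume "e \<in> {((x # y # xs) ! i, (x # y # xs) ! Suc i) | i. Suc i < length (x # y # xs)}"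
    then obtain i where "Suc i < length (x # y # xs)" "e = ((x # y # xs) ! i, (x # y # xs) ! Suc i)" by blast
    then show "e \<in> insert (x, y) {((y # xs) ! i, (y # xs) ! Suc i) | i. Suc i < length (y # xs)}"
      by (cases i) auto
  next
    fix e assume "e \<in> insert (x, y) {((y # xs) ! i, (y # xs) ! Suc i) | i. Suc i < length (y # xs)}"
    then consider "e = (x, y)" | i where "Suc i < length (y # xs)" "e = ((y # xs) ! i, (y # xs) ! Suc i)" by blast
    then show "e \<in> {((x # y # xs) ! i, (x # y # xs) ! Suc i) | i. Suc i < length (x # y # xs)}"
    proof cases
      case 1 then show ?thesis by (auto intro!: exI[of _ 0])
    next
      case (2 i) then show ?thesis by (auto intro!: exI[of _ "Suc i"])
    qed
  qed
qed auto

lemma close_cycle_nth: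
  assumes "i \<le> length cs" "cs \<noteq> []"
  shows "close_cycle cs ! i = cyc cs (int i)"
  using assms by (cases "i = length cs") (auto simp: close_cycle_def nth_append hd_conv_nth cyc_def)

lemma close_cycle_arcs:
  assumes "cs \<noteq> []"
  shows "set (vwalk_arcs (close_cycle cs)) = range (\<lambda>i. (cyc cs i, cyc cs (i + 1)))"
proof (intro equalityI subsetI)
  fix e assume "e \<in> set (vwalk_arcs (close_cycle cs))"
  then obtain i where "i < length cs" "e = (close_cycle cs ! i, close_cycle cs ! Suc i)"
    unfolding set_vwalk_arcs by (auto simp: close_cycle_def)
  then have "e = (cyc cs (int i), cyc cs (int i + 1))"
    using close_cycle_nth[of i cs] close_cycle_nth[of "Suc i" cs] assms by (simp add: add.commute)
  then show "e \<in> range (\<lambda>i. (cyc cs i, cyc cs (i + 1)))" by blast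
next
  fix e assume "e \<in> range (\<lambda>i. (cyc cs i, cyc cs (i + 1)))"
  then obtain i where e: "e = (cyc cs i, cyc cs (i + 1))" by blast
  define k where "k = nat (i mod int (length cs))"
  have k: "k < length cs" "int k = i mod int (length cs)"
    using assms by (auto simp: k_def nat_less_iff)
  have "cyc cs i = close_cycle cs ! k" "cyc cs (i + 1) = close_cycle cs ! Suc k"
    using close_cycle_nth[of k cs] close_cycle_nth[of "Suc k" cs] assms k
    by (auto intro!: cyc_cong simp: mod_eq_dvd_iff[symmetric] mod_simps add.commute)
  then show "e \<in> set (vwalk_arcs (close_cycle cs))"
    unfolding set_vwalk_arcs e using k(1) by (auto simp: close_cycle_def)
qed

lemma ucycle_iff:
  "ucycle H cs \<longleftrightarrow> 3 \<le> length cs \<and> distinct cs \<and> set cs \<subseteq> verts H \<and>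
    (\<forall>i. (cyc cs i, cyc cs (i + 1)) \<in> arcs_ends H)"
proof (cases "cs = []")
  case False
  then have "set (close_cycle cs) = set cs" by (auto simp: close_cycle_def)
  then show ?thesis
    unfolding ucycle_def vwalk_def close_cycle_arcs[OF False] by (auto simp: close_cycle_def)
qed (simp add: ucycle_def)

lemma arcs_ends_induce: "arcs_ends (with_proj G \<restriction> S) = {(u, v) \<in> parcs G. u \<in> S \<and> v \<in> S}"
  by (auto simp: arcs_ends_conv)

section \<open>Claws, chords and alternation in cyclic indices\<close>

lemma claw_freeD:
  assumes "pair_graph G" "claw_free G"
    and e: "(c, x) \<in> parcs G" "(c, y) \<in> parcs G" "(c, z) \<in> parcs G"
    and d: "x \<noteq> y" "x \<noteq> z" "y \<noteq> z"
  shows "(x, y) \<in> parcs G \<or> (x, z) \<in> parcs G \<or> (y, z) \<in> parcs G"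
proof (rule ccontr)
  interpret pair_graph G by fact
  assume n: "\<not> ?thesis"
  have s: "(u, v) \<in> parcs G \<Longrightarrow> (v, u) \<in> parcs G" for u v by (rule arcs_symmetric)
  have l: "(u, u) \<notin> parcs G" for u using no_loops' by blast
  have V: "{c, x, y, z} \<subseteq> pverts G" using e in_arcsD1 in_arcsD2 by blast
  have dd: "distinct [c, x, y, z]" using d e l by auto
  have "arcs_ends (with_proj G \<restriction> {c, x, y, z}) = {(c, x), (c, y), (c, z), (x, c), (y, c), (z, c)}"
    unfolding arcs_ends_induce using e n s l by auto
  then have "is_claw (with_proj G \<restriction> {c, x, y, z})"
    unfolding is_claw_def using dd by (intro exI[of _ c] exI[of _ x] exI[of _ y] exI[of _ z]) simp
  with V show False using assms(2) unfolding claw_free_def by blast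
qed

lemma cyc_adj:
  assumes "pair_graph G" and cs: "ucycle (with_proj G) cs"
  shows "(cyc cs i, cyc cs (i + 1)) \<in> parcs G" "(cyc cs i, cyc cs (i - 1)) \<in> parcs G"
proof -
  interpret pair_graph G by fact
  have *: "(cyc cs i, cyc cs (i + 1)) \<in> parcs G" for i using cs by (auto simp: ucycle_iff)
  show "(cyc cs i, cyc cs (i + 1)) \<in> parcs G" by (rule *)
  show "(cyc cs i, cyc cs (i - 1)) \<in> parcs G" using *[of "i - 1"] arcs_symmetric by simp
qed

text \<open>\<open>chordless\<close> provides some cycle \<open>ds\<close> on the same vertices,
  possibly in another order. Counting settles it: a vertex has at most two neighbours along
  \<open>ds\<close>, and its successor and predecessor in \<open>cs\<close> are two distinct
  ones.\<close>

lemma chordless_adj_iff: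
  assumes G: "pair_graph G" and cs: "ucycle (with_proj G) cs" and ch: "chordless G cs"
    and w: "w \<in> set cs"
  shows "(cyc cs i, w) \<in> parcs G \<longleftrightarrow> w = cyc cs (i + 1) \<or> w = cyc cs (i - 1)"
proof
  assume adj: "(cyc cs i, w) \<in> parcs G"
  have len: "3 \<le> length cs" "distinct cs" "cs \<noteq> []" using cs by (auto simp: ucycle_iff)
  obtain ds where ds: "ucycle (with_proj G \<restriction> set cs) ds" "set cs = set ds"
    "arcs_ends (with_proj G \<restriction> set cs) = set (vwalk_arcs (close_cycle ds)) \<union> (set (vwalk_arcs (close_cycle ds)))\<inverse>"
    using ch unfolding chordless_def cycle_graph_def by auto
  have ds': "distinct ds" "ds \<noteq> []" using ds(1) by (auto simp: ucycle_iff)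
  have mem: "cyc cs j \<in> set cs" for j using range_cyc[OF len(3)] by blast
  obtain j where j: "cyc cs i = cyc ds j"
    using mem[of i] range_cyc[OF ds'(2)] ds(2) by blast
  have two: "v = cyc ds (j + 1) \<or> v = cyc ds (j - 1)" if "(cyc cs i, v) \<in> parcs G" "v \<in> set cs" for v
  proof -
    have "(cyc ds j, v) \<in> arcs_ends (with_proj G \<restriction> set cs)"
      using that mem[of i] j by (simp add: arcs_ends_induce)
    then consider k where "cyc ds j = cyc ds k" "v = cyc ds (k + 1)"
      | k where "v = cyc ds k" "cyc ds j = cyc ds (k + 1)"
      unfolding ds(3) close_cycle_arcs[OF ds'(2)] by blast
    then show ?thesis
    proof cases
      case (1 k)
      then have "cyc ds (k + 1) = cyc ds (j + 1)"
        using cyc_eq_iff[OF ds', of j k] cyc_eq_iff[OF ds', of "j + 1" "k + 1"] by simp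
      with 1 show ?thesis by simp
    next
      case (2 k)
      then have "cyc ds k = cyc ds (j - 1)"
        using cyc_eq_iff[OF ds', of j "k + 1"] cyc_eq_iff[OF ds', of "j - 1" k] by (simp add: algebra_simps)
      with 2 show ?thesis by simp
    qed
  qed
  have "cyc cs (i + 1) \<noteq> cyc cs (i - 1)"
    using cyc_eq_iff[OF len(2,3), of "i + 1" "i - 1"] len(1) zdvd_imp_le[of "int (length cs)" 2] by auto
  then show "w = cyc cs (i + 1) \<or> w = cyc cs (i - 1)"
    using two[OF adj w] two[OF cyc_adj(1)[OF G cs] mem] two[OF cyc_adj(2)[OF G cs] mem] by metis
qed (use cyc_adj[OF G cs] in auto)

text \<open>Consecutive vertices are distinct, so membership in \<open>I\<close> flips at every
  step, in both directions from index 0.\<close>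

lemma cyc_alternating:
  assumes G: "pair_graph G" and cs: "ucycle (with_proj G) cs" and alt: "alternating I (close_cycle cs)"
    and hd: "cs ! 0 \<in> I"
  shows "cyc cs i \<in> I \<longleftrightarrow> even i"
proof -
  interpret pair_graph G by fact
  have len: "3 \<le> length cs" "distinct cs" "cs \<noteq> []" using cs by (auto simp: ucycle_iff)
  have step: "cyc cs (i + 1) \<in> I \<longleftrightarrow> cyc cs i \<notin> I" for i
  proof -
    have "(cyc cs i, cyc cs (i + 1)) \<in> set (vwalk_arcs (close_cycle cs))"
      unfolding close_cycle_arcs[OF len(3)] by blast
    then obtain k where k: "Suc k < length (close_cycle cs)" "close_cycle cs ! k = cyc cs i"
      "close_cycle cs ! Suc k = cyc cs (i + 1)"
      unfolding set_vwalk_arcs by auto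
    then have "card ({cyc cs i, cyc cs (i + 1)} \<inter> I) = 1"
      using alt unfolding alternating_def by metis
    moreover have "cyc cs i \<noteq> cyc cs (i + 1)" using cyc_adj(1)[OF G cs, of i] no_loops' by blast
    ultimately show ?thesis by (cases "cyc cs i \<in> I"; cases "cyc cs (i + 1) \<in> I") auto
  qed
  show ?thesis
  proof (induction i rule: int_induct[of _ 0])
    case base
    then show ?case using hd len by (simp add: cyc_def)
  next
    case (step1 i)
    then show ?case using step[of i] by auto
  next
    case (step2 i)
    then show ?case using step[of "i - 1"] by auto
  qed
qed

text \<open>Indices 0 and \<open>length cs\<close> denote the same vertex, hence have the same
  parity.\<close>

lemma length_alternating:
  assumes "pair_graph G" "ucycle (with_proj G) cs" "alternating I (close_cycle cs)" "cs ! 0 \<in> I"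
  shows "even (length cs)"
  using cyc_alternating[OF assms, of "int (length cs)"] cyc_alternating[OF assms, of 0]
    cyc_cong[of cs "int (length cs)" 0] by simp

lemma rev_cycle_simps:
  assumes "cs \<noteq> []"
  shows "length (rev_cycle cs) = length cs" "set (rev_cycle cs) = set cs"
    "distinct (rev_cycle cs) \<longleftrightarrow> distinct cs"
  using assms by (cases cs; simp add: rev_cycle_def)+

lemma cyc_rev_cycle:
  assumes "cs \<noteq> []"
  shows "cyc (rev_cycle cs) i = cyc cs (- i)"
proof -
  let ?l = "int (length cs)"
  define k where "k = nat (i mod ?l)"
  have pos: "0 < ?l" using assms by simp
  have k: "int k = i mod ?l" "k < length cs" using pos by (auto simp: k_def nat_less_iff)
  have "cyc (rev_cycle cs) i = rev_cycle cs ! k"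
    by (simp add: cyc_def k_def rev_cycle_simps[OF assms])
  \<comment> \<open>Index 0 is fixed by the reversal; only for positive \<open>k\<close> is the
    residue \<open>length cs - k\<close>.\<close>
  also have "\<dots> = cs ! nat (- int k mod ?l)"
  proof (cases k)
    case 0
    then show ?thesis using assms by (simp add: rev_cycle_def hd_conv_nth)
  next
    case (Suc m)
    have "- int k mod ?l = (?l - int k) mod ?l" by (simp only: minus_mod_self1)
    also have "\<dots> = ?l - int k" using k(2) Suc by (intro mod_pos_pos_trivial) auto
    finally have "- int k mod ?l = ?l - int k" .
    then have "nat (- int k mod ?l) = length cs - k" using k(2) by simp
    moreover have "rev_cycle cs ! k = cs ! (length cs - k)"
      using k(2) Suc by (simp add: rev_cycle_def rev_nth nth_tl Suc_diff_Suc)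
    ultimately show ?thesis by simp
  qed
  also have "\<dots> = cyc cs (- i)" unfolding cyc_def k(1) by (simp add: mod_simps)
  finally show ?thesis .
qed

lemma ucycle_two_neighbours:
  assumes "ucycle H ds" "v \<in> set ds" "sym (arcs_ends H)"
  shows "\<exists>p\<in>set ds. \<exists>q\<in>set ds. p \<noteq> q \<and> (v, p) \<in> arcs_ends H \<and> (v, q) \<in> arcs_ends H"
proof -
  have ds: "3 \<le> length ds" "distinct ds" "ds \<noteq> []"
    and arc: "(cyc ds i, cyc ds (i + 1)) \<in> arcs_ends H" for i
    using assms(1) by (auto simp: ucycle_iff)
  obtain i where v: "v = cyc ds i" using assms(2) range_cyc[OF ds(3)] by blast
  have "(v, cyc ds (i - 1)) \<in> arcs_ends H" using symD[OF assms(3) arc[of "i - 1"]] v by simp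
  moreover have "cyc ds (i + 1) \<noteq> cyc ds (i - 1)"
    using cyc_eq_iff[OF ds(2,3), of "i + 1" "i - 1"] ds(1) zdvd_imp_le[of "int (length ds)" 2] by auto
  ultimately show ?thesis using arc[of i] v range_cyc[OF ds(3)] by blast
qed

text \<open>\<open>v\<close> is not in \<open>J\<close>, being adjacent to \<open>u\<close> in the
  independent set \<open>J\<close>. Hence the two sets determine the move.\<close>

lemma ts_move_diff:
  assumes "pair_graph G" "ts_move G J u v J'"
  shows "J - J' = {u}" "J' - J = {v}"
proof -
  interpret pair_graph G by fact
  have "v \<notin> J" "u \<noteq> v"
    using assms(2) no_loops' unfolding ts_move_def independent_set_def by blast+
  then show "J - J' = {u}" "J' - J = {v}" using assms(2) unfolding ts_move_def by auto
qed

section \<open>Bad cycles and their layer digraphs\<close>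

text \<open>Alternation and chordlessness are stated through \<open>cyc\<close>, in a form preserved
  by reversal, so that every result also applies to \<open>rev_cycle cs\<close>.\<close>

locale bad_cycle_setup =
  fixes G :: "'a pair_pre_digraph" and I :: "'a set" and cs :: "'a list" and n :: nat
  assumes graph: "pair_graph G" and claw_free: "claw_free G" and indep: "independent_set G I"
    and length_cs: "length cs = 2 * n" and n_ge_4: "4 \<le> n" and distinct_cs: "distinct cs"
    and cyc_in_I: "cyc cs i \<in> I \<longleftrightarrow> even i"
    and cyc_arc_iff: "w \<in> set cs \<Longrightarrow>
      (cyc cs i, w) \<in> parcs G \<longleftrightarrow> w = cyc cs (i + 1) \<or> w = cyc cs (i - 1)"
begin

definition \<beta> :: "int \<Rightarrow> 'a" where "\<beta> i = cyc cs (2 * i + 1)"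

definition \<alpha> :: "int \<Rightarrow> 'a" where "\<alpha> i = cyc cs (2 * i)"

abbreviation adj :: "'a \<Rightarrow> 'a \<Rightarrow> bool" where "adj u v \<equiv> (u, v) \<in> parcs G"

abbreviation A :: "'a set" where "A \<equiv> set cs \<inter> I"
abbreviation B :: "'a set" where "B \<equiv> snd (bipartition I cs)"
abbreviation R :: "'a set" where "R \<equiv> I - set cs"

lemma cs_nonempty: "cs \<noteq> []"
  using length_cs n_ge_4 by auto

lemma cyc_mem: "cyc cs i \<in> set cs"
  using range_cyc[OF cs_nonempty] by blast

lemma cyc_eq: "cyc cs i = cyc cs j \<longleftrightarrow> 2 * int n dvd (i - j)"
  using cyc_eq_iff[OF distinct_cs cs_nonempty] length_cs by simp

lemma arc_sym: "adj u v \<Longrightarrow> adj v u"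
proof -
  interpret pair_graph G by (rule graph)
  show "adj u v \<Longrightarrow> adj v u" by (rule arcs_symmetric)
qed

lemma arc_irrefl: "\<not> adj u u"
proof -
  interpret pair_graph G by (rule graph)
  show "\<not> adj u u" using no_loops' by blast
qed

lemma adj_verts: "adj u v \<Longrightarrow> u \<in> pverts G \<and> v \<in> pverts G"
proof -
  interpret pair_graph G by (rule graph)
  show "adj u v \<Longrightarrow> u \<in> pverts G \<and> v \<in> pverts G" using in_arcsD1 in_arcsD2 by blast
qed

lemma I_nonadj: "u \<in> I \<Longrightarrow> v \<in> I \<Longrightarrow> \<not> adj u v"
  using indep unfolding independent_set_def by blast

lemma range_\<alpha>: "range \<alpha> = A"
proof (intro equalityI subsetI)
  fix v assume "v \<in> A"
  then obtain i where i: "v = cyc cs i" using range_cyc[OF cs_nonempty] by blast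
  then have "even i" using \<open>v \<in> A\<close> cyc_in_I by blast
  then have "v = \<alpha> (i div 2)" using i by (simp add: \<alpha>_def)
  then show "v \<in> range \<alpha>" by blast
qed (auto simp: \<alpha>_def cyc_mem cyc_in_I)

lemma range_\<beta>: "range \<beta> = B"
proof (intro equalityI subsetI)
  fix v assume "v \<in> B"
  then have v: "v \<in> set cs" "v \<notin> I" by (auto simp: bipartition_def)
  then obtain i where i: "v = cyc cs i" using range_cyc[OF cs_nonempty] by blast
  then have "odd i" using v cyc_in_I by blast
  then have "v = \<beta> (i div 2)" using i by (simp add: \<beta>_def)
  then show "v \<in> range \<beta>" by blast
qed (auto simp: \<beta>_def bipartition_def cyc_mem cyc_in_I)

lemma \<alpha>_\<beta>_adj: "adj (\<alpha> i) (\<beta> j) \<longleftrightarrow> \<beta> j = \<beta> i \<or> \<beta> j = \<beta> (i - 1)"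
  unfolding \<alpha>_def \<beta>_def cyc_arc_iff[OF cyc_mem] by (simp add: algebra_simps)

sublocale claw_free_ring "\<lambda>u v. adj u v" \<beta> "int n" R
proof
  show "adj v u" if "adj u v" for u v using that by (rule arc_sym)
  show "\<not> adj u u" for u by (rule arc_irrefl)
  show "adj x y \<or> adj x z \<or> adj y z"
    if "adj c x" "adj c y" "adj c z" "x \<noteq> y" "x \<noteq> z" "y \<noteq> z" for c x y z
    using claw_freeD[OF graph claw_free that] .
  show "4 \<le> int n" using n_ge_4 by simp
  show "\<beta> i = \<beta> j \<longleftrightarrow> int n dvd i - j" for i j
    using dvd_mult_cancel_left[of 2 "int n" "i - j"] unfolding \<beta>_def cyc_eq
    by (simp add: algebra_simps)
  have "\<not> adj (\<beta> i) (cyc cs (2 * j + 1))" for i j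
  proof -
    have "odd k" if "cyc cs k = cyc cs (2 * j + 1)" for k using that cyc_in_I[of k] cyc_in_I[of "2 * j + 1"] by simp
    from this[of "2 * i + 1 + 1"] this[of "2 * i + 1 - 1"] show ?thesis
      unfolding \<beta>_def cyc_arc_iff[OF cyc_mem] by auto
  qed
  then show "\<not> adj (\<beta> i) (\<beta> j)" for i j by (simp add: \<beta>_def)
  show "r \<noteq> \<beta> i" if "r \<in> R" for r i using that cyc_mem by (auto simp: \<beta>_def)
  \<comment> \<open>Otherwise \<open>r\<close> and the two cycle neighbours of
    \<open>\<beta> i\<close>, all in \<open>I\<close>, are the leaves of a claw centred at
    \<open>\<beta> i\<close>.\<close>
  show "\<not> adj r (\<beta> i)" if "r \<in> R" for r i
  proof
    assume r: "adj r (\<beta> i)"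
    let ?u = "cyc cs (2 * i)" and ?w = "cyc cs (2 * i + 2)"
    have uw: "?u \<in> A" "?w \<in> A" using cyc_mem cyc_in_I by auto
    have "adj (\<beta> i) ?u" "adj (\<beta> i) ?w"
      unfolding \<beta>_def cyc_arc_iff[OF cyc_mem] by (simp_all add: algebra_simps)
    moreover have "?u \<noteq> ?w"
      unfolding cyc_eq using zdvd_imp_le[of "2 * int n" 2] n_ge_4 by auto
    ultimately have "adj ?u ?w \<or> adj ?u r \<or> adj ?w r"
      using claw_freeD[OF graph claw_free, of "\<beta> i" ?u ?w r] arc_sym[OF r] uw that by blast
    then show False using I_nonadj uw that by blast
  qed
  show "\<not> adj r s" if "r \<in> R" "s \<in> R" for r s using that I_nonadj by blast
qed

lemma \<alpha>_L: "\<alpha> i \<in> L i"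
  unfolding L_def using \<alpha>_\<beta>_adj by blast

lemma config_\<alpha>: "config \<alpha>"
  unfolding config_def
proof (intro conjI allI impI ballI)
  show "\<alpha> i = \<alpha> j" if "\<beta> i = \<beta> j" for i j
    using that unfolding \<alpha>_def \<beta>_def cyc_eq by simp
qed (use \<alpha>_L range_\<alpha> I_nonadj in blast)+

section \<open>Layers and the layer digraph in integer indices\<close>

lemma nbhd_B: "nbhd G v \<inter> B = {\<beta> i | i. adj v (\<beta> i)}"
  unfolding range_\<beta>[symmetric] nbhd_def by auto

lemma nbhd_B_L: "v \<in> L i \<Longrightarrow> nbhd G v \<inter> B = {\<beta> i, \<beta> (i - 1)}"
  unfolding nbhd_B using L_adj by auto

lemma \<beta>_mem_nbhd: "\<beta> i \<in> nbhd G v \<inter> B \<longleftrightarrow> adj v (\<beta> i)"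
  unfolding range_\<beta>[symmetric] nbhd_def by simp

lemma L_iff: "v \<in> L i \<longleftrightarrow> nbhd G v \<inter> B = {\<beta> i, \<beta> (i - 1)}"
proof
  assume "nbhd G v \<inter> B = {\<beta> i, \<beta> (i - 1)}"
  then show "v \<in> L i" unfolding L_def mem_Collect_eq \<beta>_mem_nbhd[symmetric] by simp
qed (rule nbhd_B_L)

lemma N1_iff: "v \<in> N1 i \<longleftrightarrow> nbhd G v \<inter> B = {\<beta> i}"
proof
  assume "nbhd G v \<inter> B = {\<beta> i}"
  then show "v \<in> N1 i" unfolding N1_def mem_Collect_eq \<beta>_mem_nbhd[symmetric] by simp
next
  assume "v \<in> N1 i"
  then show "nbhd G v \<inter> B = {\<beta> i}" unfolding nbhd_B using N1_adj by auto
qed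

lemma L_N2:
  assumes "v \<in> L i"
  shows "v \<in> nbhd_count G 2 B"
proof -
  have "adj v (\<beta> i)" using L_adj[OF assms] by simp
  then show ?thesis
    unfolding nbhd_count_def mem_Collect_eq nbhd_B_L[OF assms]
    using adj_verts L_not_\<beta>[OF assms] \<beta>_neq[of i "i - 1"] unfolding range_\<beta>[symmetric] by auto
qed

lemma N1_count: "v \<in> nbhd_count G 1 B \<longleftrightarrow> (\<exists>i. v \<in> N1 i)"
proof
  assume "v \<in> nbhd_count G 1 B"
  then obtain w where w: "nbhd G v \<inter> B = {w}"
    by (auto simp: nbhd_count_def card_1_singleton_iff)
  then have "w \<in> range \<beta>" unfolding range_\<beta> by blast
  then show "\<exists>i. v \<in> N1 i" using w unfolding N1_iff by auto
next
  assume "\<exists>i. v \<in> N1 i"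
  then obtain i where i: "v \<in> N1 i" ..
  then have "adj v (\<beta> i)" using N1_adj by simp
  then show "v \<in> nbhd_count G 1 B"
    unfolding nbhd_count_def using adj_verts N1_not_\<beta>[OF i] i[unfolded N1_iff]
    unfolding range_\<beta>[symmetric] by auto
qed

lemma layer_eq:
  assumes "i < n"
  shows "layer G I cs i = L (int i)"
proof -
  have "cs ! (2 * i) = \<alpha> (int i)"
    using assms cyc_nth[of "2 * i" cs] length_cs by (simp add: \<alpha>_def)
  moreover have "v \<in> pverts G" if "v \<in> L (int i)" for v
    using L_adj[OF that, of "int i"] adj_verts by simp
  ultimately show ?thesis
    unfolding layer_def Let_def using nbhd_B_L[OF \<alpha>_L] by (auto simp: L_iff)
qed

lemma \<beta>_mod: "\<beta> (i mod int n) = \<beta> i"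
  unfolding \<beta>_eq_iff by (simp add: mod_eq_dvd_iff[symmetric])

lemma layer_mod: "layer G I cs (nat (i mod int n)) = L i"
proof -
  have "nat (i mod int n) < n" using n_ge_4 by (simp add: nat_less_iff)
  then show ?thesis using layer_eq[of "nat (i mod int n)"] n_ge_4 L_cong[OF \<beta>_mod] by simp
qed

lemma prev_index:
  assumes "i < n"
  shows "cs ! ((2 * i + 2 * n - 1) mod (2 * n)) = \<beta> (int i - 1)"
proof -
  have "int ((2 * i + 2 * n - 1) mod (2 * n)) = (2 * int i + 2 * int n - 1) mod (2 * int n)"
    using n_ge_4 by (simp add: zmod_int of_nat_diff)
  then have "int ((2 * i + 2 * n - 1) mod (2 * n)) = (2 * (int i - 1) + 1) mod (2 * int n)"
    by (simp add: mod_eq_dvd_iff)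
  then have "(2 * i + 2 * n - 1) mod (2 * n) = nat ((2 * (int i - 1) + 1) mod (2 * int n))"
    by (metis nat_int)
  then show ?thesis by (simp add: \<beta>_def cyc_def length_cs)
qed

text \<open>Both kinds of arcs take the same form: a vertex attached to
  \<open>\<beta> (i - 1)\<close> is in \<open>N1 (i - 1)\<close> and points into \<open>L i\<close>,
  just as the vertices of \<open>L (i - 1)\<close> do.\<close>

lemma layer_arc_iff:
  "(u, v) \<in> parcs (layer_digraph G I cs) \<longleftrightarrow> \<not> adj u v \<and> (\<exists>i. (u \<in> L i \<or> u \<in> N1 i) \<and> v \<in> L (i + 1))"
proof -
  have n: "length cs div 2 = n" "0 < n" using length_cs n_ge_4 by auto
  have next_layer: "layer G I cs ((i + 1) mod n) = L (int i + 1)" for i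
    using layer_mod[of "int i + 1"] by (simp add: nat_mod_distrib nat_add_distrib)
  show ?thesis
  proof
    assume "(u, v) \<in> parcs (layer_digraph G I cs)"
    then consider i where "i < n" "u \<in> layer G I cs i" "v \<in> layer G I cs ((i + 1) mod n)" "\<not> adj u v"
      | i where "i < n" "nbhd G u \<inter> B = {cs ! ((2 * i + 2 * n - 1) mod (2 * n))}" "v \<in> layer G I cs i" "\<not> adj u v"
      unfolding layer_digraph_def Let_def n by auto
    then show "\<not> adj u v \<and> (\<exists>i. (u \<in> L i \<or> u \<in> N1 i) \<and> v \<in> L (i + 1))"
    proof cases
      case (1 i)
      then show ?thesis using layer_eq[of i] next_layer[of i] by auto
    next
      case (2 i)
      then have "u \<in> N1 (int i - 1)" "v \<in> L (int i - 1 + 1)"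
        unfolding N1_iff using prev_index[of i] layer_eq[of i] by auto
      with 2 show ?thesis by blast
    qed
  next
    assume r: "\<not> adj u v \<and> (\<exists>i. (u \<in> L i \<or> u \<in> N1 i) \<and> v \<in> L (i + 1))"
    then obtain i where i: "u \<in> L i \<or> u \<in> N1 i" "v \<in> L (i + 1)" "\<not> adj u v" by blast
    from i(1) show "(u, v) \<in> parcs (layer_digraph G I cs)"
    proof
      assume u: "u \<in> L i"
      define k where "k = nat (i mod int n)"
      have k: "k < n" "int k = i mod int n" using n by (auto simp: k_def nat_less_iff)
      have k1: "\<beta> (int k + 1) = \<beta> (i + 1)" unfolding k(2) \<beta>_shift by (rule \<beta>_mod)
      have "u \<in> layer G I cs k" "v \<in> layer G I cs ((k + 1) mod n)"
        using u i(2) layer_mod[of i] next_layer[of k] L_cong[OF k1] by (auto simp: k_def)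
      then show ?thesis unfolding layer_digraph_def Let_def n using k(1) i(3) by auto
    next
      assume u: "u \<in> N1 i"
      \<comment> \<open>Arcs from \<open>N1 i\<close> are indexed by the layer of their head, those
        between layers by the layer of their tail.\<close>
      define k where "k = nat ((i + 1) mod int n)"
      have k: "k < n" "int k = (i + 1) mod int n" using n by (auto simp: k_def nat_less_iff)
      have "\<beta> (int k - 1) = \<beta> (i + 1 - 1)" unfolding k(2) \<beta>_shift_neg by (rule \<beta>_mod)
      then have "nbhd G u \<inter> B = {cs ! ((2 * k + 2 * n - 1) mod (2 * n))}"
        using u prev_index[OF k(1)] unfolding N1_iff by simp
      moreover have "v \<in> layer G I cs k" using i(2) layer_mod[of "i + 1"] by (simp add: k_def)
      moreover have "u \<in> nbhd_count G 1 B" using u N1_count by blast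
      ultimately show ?thesis unfolding layer_digraph_def Let_def n using k(1) i(3) by auto
    qed
  qed
qed

section \<open>Token sets and the cycles they form with B\<close>

definition tokens :: "(int \<Rightarrow> 'a) \<Rightarrow> 'a set" where
  "tokens x = range x \<union> R"

lemma tokens_\<alpha>: "tokens \<alpha> = I"
  unfolding tokens_def range_\<alpha> by blast

lemma independent_tokens:
  assumes "config x"
  shows "independent_set G (tokens x)"
proof -
  have "x i \<in> pverts G" for i
    using L_adj[OF config_L[OF assms], of i i] adj_verts by simp
  moreover have "R \<subseteq> pverts G" using indep unfolding independent_set_def by blast
  ultimately show ?thesis
    unfolding independent_set_def tokens_def
    using config_indep[OF assms] config_R[OF assms] R_indep adj_commute by auto
qed

lemma tokens_place:
  assumes "config x"
  shows "tokens (place x i v) = insert v (tokens x - {x i})"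
  unfolding tokens_def place_def
  using L_not_R[OF config_L[OF assms], of i] config_eq_iff[OF assms] by (auto simp: image_iff)

lemma ts_move_place:
  assumes "config x" "adj (x i) v" "config (place x i v)"
  shows "ts_move G (tokens x) (x i) v (tokens (place x i v))"
  unfolding ts_move_def
  using assms(2) tokens_place[OF assms(1)] independent_tokens[OF assms(1)] independent_tokens[OF assms(3)]
  by (intro conjI) (auto simp: tokens_def)

text \<open>The tokens and the vertices of B alternate around a ring, so a set containing a
  configuration is never resolved.\<close>

lemma ucycle_if_config:
  assumes x: "config x" and J: "range x \<subseteq> J"
  shows "\<exists>ds. ucycle (with_proj G \<restriction> (J \<union> B)) ds"
proof -
  \<comment> \<open>Thus \<open>f (2 * i) = x i\<close> and
    \<open>f (2 * i + 1) = \<beta> i\<close>.\<close>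
  define f where "f i = (if even i then x (i div 2) else \<beta> (i div 2))" for i
  define ds where "ds = map (\<lambda>k. f (int k)) [0..<2 * n]"
  have len: "length ds = 2 * n" by (simp add: ds_def)
  have f_cong: "f i = f j" if dvd: "2 * int n dvd i - j" for i j
  proof -
    obtain k where k: "i - j = 2 * int n * k" using dvd unfolding dvd_def by blast
    then have "i = j + 2 * (int n * k)" by simp
    then have "even i = even j" "i div 2 = j div 2 + int n * k" by simp_all
    moreover from this have "\<beta> (i div 2) = \<beta> (j div 2)" unfolding \<beta>_eq_iff by simp
    ultimately show ?thesis using config_cong[OF x, of "i div 2" "j div 2"] by (simp add: f_def)
  qed
  have cyc: "cyc ds i = f i" for i
  proof -
    have "cyc ds i = f (i mod (2 * int n))"
      using n_ge_4 unfolding cyc_def len by (simp add: ds_def nat_less_iff)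
    also have "\<dots> = f i" by (rule f_cong) (simp add: mod_eq_dvd_iff[symmetric])
    finally show ?thesis .
  qed
  have x_\<beta>: "x i \<noteq> \<beta> j" for i j using L_not_\<beta>[OF config_L[OF x]] .
  have "inj_on (\<lambda>k. f (int k)) {0..<2 * n}"
  proof (rule inj_onI)
    fix k l assume kl: "k \<in> {0..<2 * n}" "l \<in> {0..<2 * n}" "f (int k) = f (int l)"
    have par: "even k \<longleftrightarrow> even l"
      using kl(3) x_\<beta> x_\<beta>[symmetric] by (auto simp: f_def split: if_splits)
    have "\<beta> (int k div 2) = \<beta> (int l div 2)"
      using kl(3) par config_eq_iff[OF x] by (auto simp: f_def split: if_splits)
    then have "int n dvd int k div 2 - int l div 2" unfolding \<beta>_eq_iff .
    moreover have "\<bar>int k div 2 - int l div 2\<bar> < int n"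
    proof -
      have "0 \<le> int m div 2 \<and> int m div 2 < int n" if "m < 2 * n" for m using that by auto
      from this[of k] this[of l] kl(1,2) show ?thesis by auto
    qed
    ultimately have "int k div 2 = int l div 2"
      using dvd_imp_le_int[of "int k div 2 - int l div 2" "int n"] by auto
    with par show "k = l" by presburger
  qed
  then have "distinct ds" by (simp add: ds_def distinct_map)
  have f_mem: "f i \<in> J \<union> B" for i using J range_\<beta> by (auto simp: f_def)
  have arc: "adj (f i) (f (i + 1))" for i
  proof (cases "even i")
    case True
    then show ?thesis using L_adj[OF config_L[OF x], of "i div 2" "i div 2"] by (simp add: f_def)
  next
    case False
    then show ?thesis
      using L_adj[OF config_L[OF x], of "(i + 1) div 2" "i div 2"] arc_sym
      by (auto simp: f_def elim!: oddE)
  qed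
  have "ucycle (with_proj G \<restriction> (J \<union> B)) ds"
    unfolding ucycle_iff arcs_ends_induce
    using len n_ge_4 \<open>distinct ds\<close> f_mem arc cyc by (auto simp: ds_def)
  then show ?thesis ..
qed

text \<open>On a cycle every vertex has two neighbours. Here \<open>b\<close> has only
  \<open>\<beta> j\<close>, vertices of \<open>R\<close> have none, and the ring without
  \<open>x i\<close> is a path.\<close>

lemma no_ucycle_if_final:
  assumes x: "config x" and b: "b \<in> N1 j" "\<And>r. r \<in> R \<Longrightarrow> \<not> adj b r"
    and others: "\<And>m. \<beta> m \<noteq> \<beta> i \<Longrightarrow> \<not> adj b (x m)"
  shows "\<not> (\<exists>ds. ucycle (with_proj G \<restriction> (insert b (tokens x - {x i}) \<union> B)) ds)"
proof
  let ?U = "insert b (tokens x - {x i}) \<union> B"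
  assume "\<exists>ds. ucycle (with_proj G \<restriction> ?U) ds"
  then obtain ds where ds: "ucycle (with_proj G \<restriction> ?U) ds" ..
  define S where "S = set ds"
  have S_sub: "S \<subseteq> ?U" and "S \<noteq> {}" using ds by (auto simp: ucycle_iff S_def)
  have "sym (arcs_ends (with_proj G \<restriction> ?U))"
    unfolding arcs_ends_induce by (auto intro!: symI arc_sym)
  then have two: "\<exists>p\<in>S. \<exists>q\<in>S. p \<noteq> q \<and> adj v p \<and> adj v q" if "v \<in> S" for v
    using ucycle_two_neighbours[OF ds, of v] that unfolding S_def arcs_ends_induce by blast
  have kinds: "p = b \<or> p \<in> R \<or> (\<exists>m. p = x m \<and> \<beta> m \<noteq> \<beta> i) \<or> (\<exists>m. p = \<beta> m)" if "p \<in> S" for p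
    using that S_sub config_eq_iff[OF x] unfolding tokens_def range_\<beta>[symmetric] by auto
  have "b \<notin> S"
  proof
    assume "b \<in> S"
    moreover have "p = \<beta> j" if "p \<in> S" "adj b p" for p
      using kinds[OF that(1)] that(2) b others adj_irrefl N1_adj by auto
    ultimately show False using two by metis
  qed
  have nb_\<beta>: "p = x m \<or> p = x (m + 1)" if p: "p \<in> S" "adj (\<beta> m) p" for p m
  proof -
    have "p \<noteq> b \<and> p \<notin> R \<and> (\<forall>l. p \<noteq> \<beta> l)"
      using that \<open>b \<notin> S\<close> R_\<beta> \<beta>_indep arc_sym by blast
    then obtain l where l: "p = x l" using kinds[OF p(1)] by blast
    then have "\<beta> m = \<beta> l \<or> \<beta> m = \<beta> (l - 1)" using L_adj[OF config_L[OF x]] p arc_sym by blast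
    then show ?thesis using l config_cong[OF x, of m l] config_cong[OF x, of "m + 1" l] \<beta>_shift[of m 1 "l - 1"] by auto
  qed
  have nb_x: "p = \<beta> m \<or> p = \<beta> (m - 1)" if "p \<in> S" "adj (x m) p" for p m
    using kinds[OF that(1)] that \<open>b \<notin> S\<close> config_R[OF x] config_indep[OF x] L_adj[OF config_L[OF x]] by blast
  have "x i \<notin> S"
    using kinds[of "x i"] L_not_R[OF config_L[OF x]] L_not_\<beta>[OF config_L[OF x]] config_eq_iff[OF x]
      \<open>b \<notin> S\<close> by metis
  \<comment> \<open>The gap at \<open>x i\<close> unravels the ring: vertices of degree at most one are removed successively.\<close>
  have gone: "\<beta> (i + int t) \<notin> S \<and> x (i + int t) \<notin> S" for t
  proof (induction t)
    case 0
    have "\<beta> i \<notin> S" using two[of "\<beta> i"] nb_\<beta> \<open>x i \<notin> S\<close> by metis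
    with \<open>x i \<notin> S\<close> show ?case by simp
  next
    case (Suc t)
    let ?m = "i + int t + 1"
    have "x ?m \<notin> S" using two[of "x ?m"] nb_x[of _ ?m] Suc by (metis add_diff_cancel_right')
    moreover from this have "\<beta> ?m \<notin> S" using two[of "\<beta> ?m"] nb_\<beta>[of _ ?m] by metis
    ultimately show ?case by (simp add: ac_simps)
  qed
  have gone': "\<beta> m \<notin> S" "x m \<notin> S" for m
  proof -
    \<comment> \<open>The residue of \<open>m - i\<close> counts the steps from the gap to
      \<open>m\<close>.\<close>
    have "\<beta> m = \<beta> (i + int (nat ((m - i) mod int n)))"
      using n_ge_4 unfolding \<beta>_eq_iff by (simp add: mod_eq_dvd_iff[symmetric] mod_simps)
    then show "\<beta> m \<notin> S" "x m \<notin> S" using gone config_cong[OF x] by metis+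
  qed
  then have "S \<subseteq> R" using kinds \<open>b \<notin> S\<close> by blast
  with \<open>S \<noteq> {}\<close> two R_indep show False by blast
qed

section \<open>From directed paths to resolving sequences\<close>

text \<open>An internal resolving sequence with its first set left open, so that moves can be added
  at the front.\<close>

definition finishing :: "'a set list \<Rightarrow> bool" where
  "finishing Js \<longleftrightarrow> ts_sequence G Js \<and> \<not> (\<exists>ds. ucycle (with_proj G \<restriction> (last Js \<union> B)) ds) \<and>
    (\<forall>i u v. Suc (Suc i) < length Js \<and> ts_move G (Js ! i) u v (Js ! Suc i) \<longrightarrow> {u, v} \<subseteq> nbhd_count G 2 B)"

lemma internally_resolvable_iff: "internally_resolvable G I cs \<longleftrightarrow> (\<exists>Js. finishing Js \<and> hd Js = I)"
  unfolding internally_resolvable_def internal_resolving_sequence_def resolving_sequence_def finishing_def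
  by blast

lemma finishing_if_solvable:
  assumes "solvable b x" "b \<in> N1 j" "\<And>r. r \<in> R \<Longrightarrow> \<not> adj b r"
  shows "\<exists>Js. finishing Js \<and> hd Js = tokens x"
  using assms(1)
proof (induction rule: solvable.induct)
  case (final x i)
  let ?J = "insert b (tokens x - {x i})"
  have "independent_set G ?J"
    using independent_tokens[OF final(1)] final assms(3) adj_verts[OF final(2)] adj_commute adj_irrefl
      config_eq_iff[OF final(1)]
    unfolding independent_set_def tokens_def by auto
  then have "ts_move G (tokens x) (x i) b ?J"
    unfolding ts_move_def using final(2) independent_tokens[OF final(1)] by (auto simp: tokens_def)
  then have "ts_sequence G [tokens x, ?J]"
    unfolding ts_sequence_def ts_move_def by (auto simp: less_Suc_eq)
  \<comment> \<open>The only move is the last one, so internality is vacuous.\<close>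
  then have "finishing [tokens x, ?J]"
    unfolding finishing_def using no_ucycle_if_final[OF final(1) assms(2,3) final(3)] by simp
  then show ?case by (intro exI[of _ "[tokens x, ?J]"]) simp
next
  case (step x v i)
  then obtain Js where Js: "finishing Js" "hd Js = tokens (place x i v)" by blast
  have ne: "Js \<noteq> []" using Js(1) unfolding finishing_def ts_sequence_def by blast
  then have Js0: "Js ! 0 = tokens (place x i v)" using Js(2) by (simp add: hd_conv_nth)
  note mv = ts_move_place[OF step(1,3,4)]
  have "finishing (tokens x # Js)"
    unfolding finishing_def ts_sequence_def
  proof (intro conjI allI impI ballI)
    show "independent_set G J" if "J \<in> set (tokens x # Js)" for J
      using that Js(1) independent_tokens[OF step(1)] unfolding finishing_def ts_sequence_def by auto
    show "\<exists>u v. ts_move G ((tokens x # Js) ! k) u v ((tokens x # Js) ! Suc k)"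
      if "Suc k < length (tokens x # Js)" for k
      using that mv Js(1) Js0 unfolding finishing_def ts_sequence_def by (cases k) auto
    show "\<not> (\<exists>ds. ucycle (with_proj G \<restriction> (last (tokens x # Js) \<union> B)) ds)"
      using Js(1) ne unfolding finishing_def by simp
    fix k u w assume a: "Suc (Suc k) < length (tokens x # Js) \<and>
      ts_move G ((tokens x # Js) ! k) u w ((tokens x # Js) ! Suc k)"
    show "{u, w} \<subseteq> nbhd_count G 2 B"
    proof (cases k)
      case 0
      then have "ts_move G (tokens x) u w (tokens (place x i v))" using a Js0 by simp
      \<comment> \<open>Internality speaks of all \<open>u\<close>, \<open>w\<close> realising the
        move; the two sets identify them.\<close>
      then have "{u} = {x i}" "{w} = {v}"
        using ts_move_diff[OF graph, of "tokens x"] mv by metis+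
      then show ?thesis using L_N2 config_L[OF step(1)] step(2) by blast
    next
      case (Suc l)
      then show ?thesis using a Js(1) unfolding finishing_def by auto
    qed
  qed simp
  then show ?case by (intro exI[of _ "tokens x # Js"]) simp
qed

text \<open>The condition on \<open>nbhd G b \<inter> I\<close> keeps \<open>b\<close> non-adjacent
  to \<open>R\<close>, so that no token off the cycle blocks the last move.\<close>

lemma resolvable_if_path:
  assumes b: "b \<in> nbhd_count G 1 B" "nbhd G b \<inter> I \<subseteq> A" and a: "a \<in> A"
    and path: "(b, a) \<in> (parcs (layer_digraph G I cs))\<^sup>*"
  shows "internally_resolvable G I cs"
proof -
  obtain j where j: "b \<in> N1 j" using b(1) N1_count by blast
  obtain m where m: "a = \<alpha> m" using a range_\<alpha> by blast
  obtain k f where f: "f 0 = b" "f k = a"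
    "\<And>s. s < k \<Longrightarrow> (f s, f (Suc s)) \<in> parcs (layer_digraph G I cs)"
    using rtrancl_imp_relpow[OF path] unfolding relpow_fun_conv by blast
  have R: "\<not> adj b r" if "r \<in> R" for r
    using that b(2) unfolding nbhd_def by blast
  \<comment> \<open>\<open>a\<close> lies in a layer, \<open>b\<close> in
    \<open>N1 j\<close>.\<close>
  have "k \<noteq> 0"
    using f(1,2) m j L_N1_disjoint[OF \<alpha>_L] by (metis)
  \<comment> \<open>Each arc comes with some index \<open>i\<close>; uniqueness of indices forces it
    to be \<open>j + int s\<close> modulo \<open>n\<close>.\<close>
  have fL: "(s = 0 \<and> f s \<in> N1 j) \<or> (0 < s \<and> f s \<in> L (j + int s))" if "s \<le> k" for s
    using that
  proof (induction s)
    case 0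
    then show ?case using f(1) j by simp
  next
    case (Suc s)
    obtain i where i: "f s \<in> L i \<or> f s \<in> N1 i" "f (Suc s) \<in> L (i + 1)"
      using f(3)[of s] Suc.prems unfolding layer_arc_iff by auto
    have "f s \<in> N1 j \<and> s = 0 \<or> f s \<in> L (j + int s)" using Suc by auto
    then have "\<beta> i = \<beta> (j + int s)"
    proof
      assume s: "f s \<in> N1 j \<and> s = 0"
      then have "\<beta> i = \<beta> j" using i(1) L_N1_disjoint N1_unique by blast
      with s show ?thesis by simp
    next
      assume "f s \<in> L (j + int s)"
      then show ?thesis using i(1) L_N1_disjoint L_unique by blast
    qed
    then have "L (i + 1) = L (j + int s + 1)" by (intro L_cong) (simp only: \<beta>_shift)
    then show ?case using i(2) by (simp add: ac_simps)
  qed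
  have "solvable b \<alpha>"
  proof (rule solvable_if_path[of b j f \<alpha> k, OF j f(1) config_\<alpha>])
    show "f k = \<alpha> (j + int k)"
    proof -
      have "\<alpha> m \<in> L (j + int k)" using fL[of k] \<open>k \<noteq> 0\<close> f(2) m by auto
      then have "\<beta> m = \<beta> (j + int k)" using L_unique[OF \<alpha>_L] by blast
      then show ?thesis using config_cong[OF config_\<alpha>] f(2) m by metis
    qed
    show "\<not> adj (f s) (f (Suc s))" if "s < k" for s using f(3)[OF that] unfolding layer_arc_iff by blast
  qed (use fL \<open>k \<noteq> 0\<close> in auto)
  then show ?thesis
    using finishing_if_solvable[OF _ j R] tokens_\<alpha> internally_resolvable_iff by metis
qed

section \<open>From resolving sequences to directed paths\<close>

lemma move_others:
  assumes x: "config x" and mv: "ts_move G (tokens x) (x i) v J'"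
  shows "\<beta> m \<noteq> \<beta> i \<Longrightarrow> v \<noteq> x m \<and> \<not> adj v (x m)" and "r \<in> R \<Longrightarrow> \<not> adj v r"
proof -
  have J': "J' = insert v (tokens x - {x i})" "independent_set G J'" "v \<notin> tokens x"
    using mv ts_move_diff[OF graph mv] unfolding ts_move_def by auto
  show "v \<noteq> x m \<and> \<not> adj v (x m)" if "\<beta> m \<noteq> \<beta> i"
  proof -
    have "x m \<in> J'" "x m \<in> tokens x" using that config_eq_iff[OF x] J'(1) by (auto simp: tokens_def)
    then show ?thesis using J' unfolding independent_set_def by auto
  qed
  show "\<not> adj v r" if "r \<in> R"
    using that J' L_not_R[OF config_L[OF x]] unfolding independent_set_def tokens_def by auto
qed

lemma config_if_move:
  assumes x: "config x" and mv: "ts_move G (tokens x) (x i) v J'" and v: "v \<in> L i"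
  shows "config (place x i v)" "tokens (place x i v) = J'"
  using config_place[OF x v] move_others[OF x mv] \<beta>_neq[of "i + 1" i] \<beta>_neq[of "i - 1" i]
    tokens_place[OF x] mv unfolding ts_move_def by auto

text \<open>The bound on \<open>t\<close> leaves out the last set, so every move made up to
  \<open>Js ! t\<close> is internal. Reachability of \<open>A\<close> survives a move because the
  new token has an arc to an unmoved one.\<close>

lemma state_invariant:
  assumes Js: "finishing Js" "hd Js = I" and t: "Suc t < length Js"
  shows "\<exists>x. config x \<and> Js ! t = tokens x \<and> (\<forall>m. \<exists>a\<in>A. (x m, a) \<in> (parcs (layer_digraph G I cs))\<^sup>*)"
  using t
proof (induction t)
  case 0
  have "Js ! 0 = tokens \<alpha>" using 0 Js(2) tokens_\<alpha> hd_conv_nth[of Js] by fastforce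
  then show ?case using config_\<alpha> range_\<alpha> by blast
next
  case (Suc t)
  then obtain x where x: "config x" "Js ! t = tokens x"
    and reach: "\<And>m. \<exists>a\<in>A. (x m, a) \<in> (parcs (layer_digraph G I cs))\<^sup>*" by auto
  obtain u v where mv: "ts_move G (tokens x) u v (Js ! Suc t)"
    using Js(1) Suc.prems x(2) unfolding finishing_def ts_sequence_def by (metis Suc_lessD)
  then have N2: "{u, v} \<subseteq> nbhd_count G 2 B"
    using Js(1) Suc.prems x(2) unfolding finishing_def by metis
  \<comment> \<open>Tokens off the cycle have no neighbour in B and thus make no internal
    move.\<close>
  have "u \<notin> R"
  proof
    assume "u \<in> R"
    then have "nbhd G u \<inter> B = {}" unfolding nbhd_B using R_\<beta> by blast
    then show False using N2 by (simp add: nbhd_count_def)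
  qed
  then obtain i where u: "u = x i" using mv unfolding ts_move_def tokens_def by blast
  note mv = mv[unfolded u]
  \<comment> \<open>Only the two vertices of B around \<open>x i\<close> are possible neighbours of
    \<open>v\<close>; having two neighbours in B, it has both.\<close>
  have "nbhd G v \<inter> B \<subseteq> {\<beta> i, \<beta> (i - 1)}"
    unfolding nbhd_B using moved_adj_\<beta>[OF x(1) move_others(1)[OF x(1) mv]] by auto
  moreover have "card (nbhd G v \<inter> B) = 2" using N2 by (simp add: nbhd_count_def)
  ultimately have "nbhd G v \<inter> B = {\<beta> i, \<beta> (i - 1)}"
    using \<beta>_neq[of i "i - 1"] by (intro card_subset_eq) auto
  then have v: "v \<in> L i" unfolding L_iff .
  note c = config_if_move[OF x(1) mv v]
  have "\<not> adj v (x (i + 1))" using move_others(1)[OF x(1) mv] \<beta>_neq[of "i + 1" i] by simp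
  then have "(v, x (i + 1)) \<in> parcs (layer_digraph G I cs)"
    unfolding layer_arc_iff using v config_L[OF x(1)] by blast
  then have "\<exists>a\<in>A. (v, a) \<in> (parcs (layer_digraph G I cs))\<^sup>*"
    using reach[of "i + 1"] by (meson converse_rtrancl_into_rtrancl)
  then have "\<exists>a\<in>A. (place x i v m, a) \<in> (parcs (layer_digraph G I cs))\<^sup>*" for m
    using reach[of m] by (simp add: place_def)
  with c show ?case by metis
qed

text \<open>By \<open>ucycle_if_config\<close> the last set contains no configuration. Hence a last
  move exists, it moves a ring token, and its target lies outside the layer of that token;
  \<open>moved_N1\<close> then applies.\<close>

lemma final_move:
  assumes Js: "finishing Js" "hd Js = I"
  shows "\<exists>t x i b. Suc t < length Js \<and> config x \<and> Js ! t = tokens x \<and> (b \<in> N1 i \<or> b \<in> N1 (i - 1)) \<and>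
    (\<forall>m. \<beta> m \<noteq> \<beta> i \<longrightarrow> \<not> adj b (x m)) \<and> nbhd G b \<inter> I \<subseteq> A"
proof -
  have ne: "Js \<noteq> []" and acyclic: "\<not> (\<exists>ds. ucycle (with_proj G \<restriction> (last Js \<union> B)) ds)"
    using Js(1) unfolding finishing_def ts_sequence_def by blast+
  have "length Js \<noteq> 1"
  proof
    assume "length Js = 1"
    then have "last Js = hd Js" by (cases Js) auto
    then have "last Js = tokens \<alpha>" using Js(2) tokens_\<alpha> by simp
    then show False using acyclic ucycle_if_config[OF config_\<alpha>, of "last Js"] by (simp add: tokens_def)
  qed
  moreover have "length Js \<noteq> 0" using ne by simp
  ultimately have len: "2 \<le> length Js" by linarith
  define t where "t = length Js - 2"
  have t: "Suc t < length Js" "Js ! Suc t = last Js"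
    using len by (auto simp: t_def last_conv_nth ne Suc_diff_Suc numeral_2_eq_2)
  obtain x where x: "config x" "Js ! t = tokens x" using state_invariant[OF Js t(1)] by blast
  obtain u b where mv: "ts_move G (tokens x) u b (last Js)"
    using Js(1) t x(2) unfolding finishing_def ts_sequence_def by metis
  have "u \<notin> R"
  proof
    assume "u \<in> R"
    then have "range x \<subseteq> last Js"
      using mv L_not_R[OF config_L[OF x(1)]] unfolding ts_move_def tokens_def by auto
    then show False using acyclic ucycle_if_config[OF x(1)] by blast
  qed
  then obtain i where u: "u = x i" using mv unfolding ts_move_def tokens_def by blast
  note mv = mv[unfolded u]
  note others = move_others(1)[OF x(1) mv]
  \<comment> \<open>\<open>\<beta> m\<close> is adjacent to \<open>x m\<close> and
    \<open>x (m + 1)\<close>, at least one of which does not move.\<close>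
  have "b \<notin> range \<beta>"
  proof
    assume "b \<in> range \<beta>"
    then obtain m where m: "b = \<beta> m" by blast
    have "\<beta> m \<noteq> \<beta> i \<or> \<beta> (m + 1) \<noteq> \<beta> i" using \<beta>_neq[of m "m + 1"] by auto
    then show False
      using others[of m] others[of "m + 1"] m L_adj[OF config_L[OF x(1)], of m m]
        L_adj[OF config_L[OF x(1)], of "m + 1" m] arc_sym by auto
  qed
  moreover have "b \<notin> L i"
  proof
    assume "b \<in> L i"
    note c = config_if_move[OF x(1) mv this]
    then have "range (place x i b) \<subseteq> last Js" unfolding tokens_def by blast
    then show False using acyclic ucycle_if_config[OF c(1)] by blast
  qed
  moreover have "adj (x i) b" using mv unfolding ts_move_def by blast
  ultimately have "b \<in> N1 i \<or> b \<in> N1 (i - 1)"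
    using moved_N1[OF x(1) others] by blast
  moreover have "nbhd G b \<inter> I \<subseteq> A"
    using move_others(2)[OF x(1) mv] unfolding nbhd_def by blast
  ultimately show ?thesis using t(1) x others by blast
qed

section \<open>The reversed cycle and the equivalence\<close>

lemma bad_cycle_setup_rev: "bad_cycle_setup G I (rev_cycle cs) n"
proof (rule bad_cycle_setup.intro)
  show "length (rev_cycle cs) = 2 * n" "distinct (rev_cycle cs)"
    using length_cs distinct_cs rev_cycle_simps[OF cs_nonempty] by auto
  show "cyc (rev_cycle cs) i \<in> I \<longleftrightarrow> even i" for i
    unfolding cyc_rev_cycle[OF cs_nonempty] cyc_in_I by simp
  show "(cyc (rev_cycle cs) i, w) \<in> parcs G \<longleftrightarrow>
      w = cyc (rev_cycle cs) (i + 1) \<or> w = cyc (rev_cycle cs) (i - 1)"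
    if "w \<in> set (rev_cycle cs)" for w i
  proof -
    have "- (i + 1) = - i - 1" "- (i - 1) = - i + 1" by simp_all
    then show ?thesis
      using cyc_arc_iff[of w "- i"] that
      unfolding cyc_rev_cycle[OF cs_nonempty] rev_cycle_simps[OF cs_nonempty]
      by (simp only:) blast
  qed
qed (use graph claw_free indep n_ge_4 in auto)

lemma bipartition_rev: "bipartition I (rev_cycle cs) = bipartition I cs"
  unfolding bipartition_def rev_cycle_simps[OF cs_nonempty] ..

lemma internally_resolvable_rev:
  "internally_resolvable G I (rev_cycle cs) \<longleftrightarrow> internally_resolvable G I cs"
  unfolding internally_resolvable_def internal_resolving_sequence_def resolving_sequence_def bipartition_rev ..

text \<open>Reversal replaces \<open>\<beta> i\<close> by \<open>\<beta> (- i - 1)\<close> and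
  \<open>L i\<close> by \<open>L (- i)\<close>, so in the original indices arcs lead one layer
  down.\<close>

lemma layer_rev_arc_iff:
  "(u, v) \<in> parcs (layer_digraph G I (rev_cycle cs)) \<longleftrightarrow>
    \<not> adj u v \<and> (\<exists>i. (u \<in> L i \<or> u \<in> N1 (i - 1)) \<and> v \<in> L (i - 1))"
proof -
  interpret rev: bad_cycle_setup G I "rev_cycle cs" n by (rule bad_cycle_setup_rev)
  have \<beta>: "rev.\<beta> i = \<beta> (- i - 1)" for i
    unfolding rev.\<beta>_def \<beta>_def cyc_rev_cycle[OF cs_nonempty] by (simp add: algebra_simps)
  have L: "rev.L i = L (- i)" for i
    unfolding set_eq_iff rev.L_iff L_iff \<beta> bipartition_rev by (simp add: insert_commute)
  have N: "rev.N1 i = N1 (- i - 1)" for i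
    unfolding set_eq_iff rev.N1_iff N1_iff \<beta> bipartition_rev by simp
  have "(\<exists>i. (u \<in> L (- i) \<or> u \<in> N1 (- i - 1)) \<and> v \<in> L (- (i + 1))) \<longleftrightarrow>
      (\<exists>i. (u \<in> L i \<or> u \<in> N1 (i - 1)) \<and> v \<in> L (i - 1))"
    by (metis (no_types) add_uminus_conv_diff minus_add_distrib minus_minus)
  then show ?thesis unfolding rev.layer_arc_iff L N by simp
qed

text \<open>When \<open>x i\<close> makes the last move, the other token around the neighbour of
  \<open>b\<close> in B is \<open>x (i + 1)\<close> or \<open>x (i - 1)\<close>; this decides which
  of the two digraphs contains the path.\<close>

lemma resolvable_iff_reach:
  "internally_resolvable G I cs \<longleftrightarrow>
    (\<exists>D \<in> {layer_digraph G I cs, layer_digraph G I (rev_cycle cs)}.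
       \<exists>b \<in> nbhd_count G 1 B. nbhd G b \<inter> I \<subseteq> A \<and> (\<exists>a\<in>A. (b, a) \<in> (parcs D)\<^sup>*))"
proof
  interpret rev: bad_cycle_setup G I "rev_cycle cs" n by (rule bad_cycle_setup_rev)
  have R: "set (rev_cycle cs) = set cs" using rev_cycle_simps[OF cs_nonempty] by simp
  {
    assume "internally_resolvable G I cs"
    then obtain Js where Js: "finishing Js" "hd Js = I" unfolding internally_resolvable_iff by blast
    have Js': "rev.finishing Js" using Js(1) unfolding rev.finishing_def finishing_def bipartition_rev .
    obtain t x i b where t: "Suc t < length Js" and x: "config x" "Js ! t = tokens x"
      and b: "b \<in> N1 i \<or> b \<in> N1 (i - 1)" "\<And>m. \<beta> m \<noteq> \<beta> i \<Longrightarrow> \<not> adj b (x m)" "nbhd G b \<inter> I \<subseteq> A"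
      using final_move[OF Js] by blast
    have x_mem: "x m \<in> tokens x" "x m \<notin> R" for m
      using L_not_R[OF config_L[OF x(1)]] by (auto simp: tokens_def)
    have b1: "b \<in> nbhd_count G 1 B" using b(1) N1_count by blast
    show "\<exists>D \<in> {layer_digraph G I cs, layer_digraph G I (rev_cycle cs)}.
       \<exists>b \<in> nbhd_count G 1 B. nbhd G b \<inter> I \<subseteq> A \<and> (\<exists>a\<in>A. (b, a) \<in> (parcs D)\<^sup>*)"
      using b(1)
    proof
      assume "b \<in> N1 i"
      then have arc: "(b, x (i + 1)) \<in> parcs (layer_digraph G I cs)"
        unfolding layer_arc_iff using b(2) \<beta>_neq[of "i + 1" i] config_L[OF x(1)] by auto
      \<comment> \<open>The configuration \<open>y\<close> is only known to have the same token set
        as \<open>x\<close>; as \<open>x (i + 1)\<close> is not in \<open>R\<close>, it is some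
        \<open>y m\<close>.\<close>
      obtain y where "Js ! t = tokens y" "\<And>m. \<exists>a\<in>A. (y m, a) \<in> (parcs (layer_digraph G I cs))\<^sup>*"
        using state_invariant[OF Js t] by blast
      then have "\<exists>a\<in>A. (x (i + 1), a) \<in> (parcs (layer_digraph G I cs))\<^sup>*"
        using x_mem[of "i + 1"] x(2) by (auto simp: tokens_def)
      then show ?thesis using arc b1 b(3) by (blast intro: converse_rtrancl_into_rtrancl)
    next
      assume "b \<in> N1 (i - 1)"
      then have arc: "(b, x (i - 1)) \<in> parcs (layer_digraph G I (rev_cycle cs))"
        unfolding layer_rev_arc_iff using b(2) \<beta>_neq[of "i - 1" i] config_L[OF x(1)] by auto
      obtain y where "Js ! t = rev.tokens y"
        "\<And>m. \<exists>a\<in>A. (y m, a) \<in> (parcs (layer_digraph G I (rev_cycle cs)))\<^sup>*"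
        using rev.state_invariant[OF Js' Js(2) t] unfolding R by blast
      then have "\<exists>a\<in>A. (x (i - 1), a) \<in> (parcs (layer_digraph G I (rev_cycle cs)))\<^sup>*"
        using x_mem[of "i - 1"] x(2) by (auto simp: rev.tokens_def R)
      then show ?thesis using arc b1 b(3) by (blast intro: converse_rtrancl_into_rtrancl)
    qed
  next
    assume "\<exists>D \<in> {layer_digraph G I cs, layer_digraph G I (rev_cycle cs)}.
       \<exists>b \<in> nbhd_count G 1 B. nbhd G b \<inter> I \<subseteq> A \<and> (\<exists>a\<in>A. (b, a) \<in> (parcs D)\<^sup>*)"
    then show "internally_resolvable G I cs"
      using resolvable_if_path rev.resolvable_if_path
      unfolding internally_resolvable_rev bipartition_rev R by blast
  }
qed

end

lemma pair_wf_layer_digraph: "pair_graph G \<Longrightarrow> pair_wf_digraph (layer_digraph G I cs)"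
  by unfold_locales (auto simp: layer_digraph_def Let_def layer_def nbhd_count_def)

text \<open>Walks shorten to paths; the assumption on \<open>u\<close> covers the trivial walk,
  since reachability is reflexive only on vertices.\<close>

lemma (in pair_wf_digraph) apath_iff_rtrancl:
  assumes "u \<in> pverts G"
  shows "(\<exists>p. apath u p v) \<longleftrightarrow> (u, v) \<in> (parcs G)\<^sup>*"
  using reachable_apath[of u v] reachable_conv'[OF assms] by simp

theorem theorem14:
  fixes G :: "'a pair_pre_digraph" and I A B :: "'a set" and cs :: "'a list"
  assumes "pair_graph G" and "claw_free G"
    and "independent_set G I"
    and "bad_cycle G I cs" and "cs ! 0 \<in> I"
    and "bipartition I cs = (A, B)"
    and "length cs \<ge> 8"
  shows "internally_resolvable G I cs \<longleftrightarrow>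
    (\<exists>D \<in> {layer_digraph G I cs, layer_digraph G I (rev_cycle cs)}.
       \<exists>b \<in> nbhd_count G 1 B. nbhd G b \<inter> I \<subseteq> A \<and>
         (\<exists>a \<in> A. \<exists>p. pre_digraph.apath (with_proj D) b p a))"
proof -
  have cs: "ucycle (with_proj G) cs" "alternating I (close_cycle cs)" "chordless G cs"
    using assms(4) unfolding bad_cycle_def by auto
  \<comment> \<open>Alternation makes the length even, so the division is exact.\<close>
  define n where "n = length cs div 2"
  have n: "length cs = 2 * n" using length_alternating[OF assms(1) cs(1,2) assms(5)] by (simp add: n_def)
  interpret bad_cycle_setup G I cs n
  proof (rule bad_cycle_setup.intro)
    show "cyc cs i \<in> I \<longleftrightarrow> even i" for i by (rule cyc_alternating[OF assms(1) cs(1,2) assms(5)])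
    show "(cyc cs i, w) \<in> parcs G \<longleftrightarrow> w = cyc cs (i + 1) \<or> w = cyc cs (i - 1)" if "w \<in> set cs" for i w
      by (rule chordless_adj_iff[OF assms(1) cs(1,3) that])
  qed (use assms n cs(1) in \<open>auto simp: ucycle_iff\<close>)
  have AB: "A = set cs \<inter> I" "B = snd (bipartition I cs)" using assms(6) by (auto simp: bipartition_def)
  have "(\<exists>p. pre_digraph.apath (with_proj (layer_digraph G I ds)) b p a) \<longleftrightarrow>
      (b, a) \<in> (parcs (layer_digraph G I ds))\<^sup>*" if "b \<in> nbhd_count G 1 B" for b a ds
    using pair_wf_digraph.apath_iff_rtrancl[OF pair_wf_layer_digraph[OF assms(1)], of b I ds a] that
    by (auto simp: layer_digraph_def Let_def nbhd_count_def)
  then show ?thesis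
    using resolvable_iff_reach unfolding AB by auto
qed

end
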